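(* (Stochastic sewing lemma with random controls.) Let $0\le S<T<\infty$ and $m\in[2,\infty)$. Let $A:\Delta_{S,T}\to L_m(\Omega)$ be such that $A_{s,t}$ is $\mathcal{F}_t$-measurable for every $(s,t)\in\Delta_{S,T}$, and let $\lambda$ be a random control. Assume that there exist constants $\Gamma_1,\alpha_1,\beta_1\ge0$ such that $\alpha_1+\beta_1>1$ and $$|\mathsf{E}^u\delta A_{s,u,t}|\le\Gamma_1|t-s|^{\alpha_1}\lambda(s,t)^{\beta_1}\quad\text{a.s.}$$ for every $(s,t)\in\Delta_{S,T}$ and $u:=(s+t)/2$. Assume further that there exist $\Gamma_2\ge0$, $\varepsilon_2>0$ such that $\|\delta A_{s,u,t}\|_{L_m}\le\Gamma_2|t-s|^{\frac12+\varepsilon_2}$ for every $(s,t)\in\Delta_{S,T}$ and $u:=(s+t)/2$, and that there exists a process $\mathcal{A}=\{\mathcal{A}_t:t\in[S,T]\}$ such that for any $t\in[S,T]$ and any sequence of partitions $\Pi_N=\{S=t^N_0,\dots,t^N_{k(N)}=t\}$ of $[S,t]$ with mesh size tending to $0$ one has $\mathcal{A}_t=\lim_{N\to\infty}\sum_{i=0}^{k(N)-1}A_{t^N_i,t^N_{i+1}}$ in probability. Then there exist a map $B:\Delta_{S,T}\to L_m(\Omega)$ and a constant $C>0$ such that $B$ is a functional of $\bigl((s,t)\mapsto\delta A_{s,(s+t)/2,t}\bigr)$ and for every $(s,t)\in\Delta_{S,T}$ $$|\mathcal{A}_t-\mathcal{A}_s-A_{s,t}|\le C\Gamma_1|t-s|^{\alpha_1}\lambda(s,t)^{\beta_1}+B_{s,t}\quad\text{a.s.}$$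 and $$\|B_{s,t}\|_{L_m}\le C\Gamma_2|t-s|^{\frac12+\varepsilon_2}.$$
   Context: $(\Omega,\mathcal{F},(\mathcal{F}_t)_{t\in[0,T]},\mathsf{P})$ is a filtered probability space; $\mathsf{E}^u[\cdot]=\mathsf{E}[\cdot|\mathcal{F}_u]$. $\Delta_{S,T}=\{(s,t)\in[S,T]^2:s\le t\}$. For $S\le s\le u\le t\le T$, $\delta A_{s,u,t}:=A_{s,t}-A_{s,u}-A_{u,t}$. A random control is a measurable function $\lambda:\Delta_{S,T}\times\Omega\to\mathbb{R}_+$ such that for any $S\le s\le u\le t\le T$ one has $\lambda(s,u,\omega)+\lambda(u,t,\omega)\le\lambda(s,t,\omega)$ a.s. "$B$ is a functional of $((s,t)\mapsto\delta A_{s,(s+t)/2,t})$" means that $B$ is determined by (depends on $A$ only through) this family of random variables and the filtration. *)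

theory Defs
  imports "HOL-Probability.Probability"
begin

text \<open>Random variables are represented by functions on the sample space; two-parameter families
  are total functions of two real arguments, of which only the values on the simplex matter.\<close>

definition simplex2 :: "real \<Rightarrow> real \<Rightarrow> (real \<times> real) set" where
  "simplex2 S T = {(s, t). S \<le> s \<and> s \<le> t \<and> t \<le> T}"

definition filtration_on :: "'a measure \<Rightarrow> real \<Rightarrow> (real \<Rightarrow> 'a measure) \<Rightarrow> bool" where
  "filtration_on M T F \<longleftrightarrow>
     (\<forall>t\<in>{0..T}. subalgebra M (F t)) \<and>
     (\<forall>s t. 0 \<le> s \<longrightarrow> s \<le> t \<longrightarrow> t \<le> T \<longrightarrow> sets (F s) \<subseteq> sets (F t))"

definition Lm_space :: "'a measure \<Rightarrow> real \<Rightarrow> ('a \<Rightarrow> real) set" where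
  "Lm_space M m = {f \<in> borel_measurable M. integrable M (\<lambda>\<omega>. \<bar>f \<omega>\<bar> powr m)}"

definition Lm_norm :: "'a measure \<Rightarrow> real \<Rightarrow> ('a \<Rightarrow> real) \<Rightarrow> real" where
  "Lm_norm M m f = (\<integral>\<omega>. \<bar>f \<omega>\<bar> powr m \<partial>M) powr (1 / m)"

definition increment :: "(real \<Rightarrow> real \<Rightarrow> 'a \<Rightarrow> real) \<Rightarrow> real \<Rightarrow> real \<Rightarrow> real \<Rightarrow> 'a \<Rightarrow> real" where
  "increment A s u t = (\<lambda>\<omega>. A s t \<omega> - A s u \<omega> - A u t \<omega>)"

definition midpoint_increments ::
    "(real \<Rightarrow> real \<Rightarrow> 'a \<Rightarrow> real) \<Rightarrow> real \<Rightarrow> real \<Rightarrow> 'a \<Rightarrow> real" where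
  "midpoint_increments A = (\<lambda>s t. increment A s ((s + t) / 2) t)"

text \<open>Power of a nonnegative base with the convention \<open>0\<^sup>0 = 1\<close>; the library has
  \<^term>\<open>(0::real) powr 0 = 0\<close>.\<close>

definition npow :: "real \<Rightarrow> real \<Rightarrow> real" where
  "npow x a = (if a = 0 then 1 else x powr a)"

definition random_control ::
    "'a measure \<Rightarrow> real \<Rightarrow> real \<Rightarrow> (real \<Rightarrow> real \<Rightarrow> 'a \<Rightarrow> real) \<Rightarrow> bool" where
  "random_control M S T l \<longleftrightarrow>
     (\<lambda>((s, t), \<omega>). l s t \<omega>) \<in> borel_measurable (restrict_space borel (simplex2 S T) \<Otimes>\<^sub>M M) \<and>
     (\<forall>(s, t)\<in>simplex2 S T. \<forall>\<omega>\<in>space M. 0 \<le> l s t \<omega>) \<and>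
     (\<forall>s u t. S \<le> s \<longrightarrow> s \<le> u \<longrightarrow> u \<le> t \<longrightarrow> t \<le> T \<longrightarrow>
        (AE \<omega> in M. l s u \<omega> + l u t \<omega> \<le> l s t \<omega>))"

text \<open>\<open>p 0, \<dots>, p k\<close> are the points of a partition of \<open>[a, b]\<close>; the degenerate interval
  \<open>[a, a]\<close> has the single partition with \<open>k = 0\<close>.\<close>

definition is_partition :: "real \<Rightarrow> real \<Rightarrow> nat \<Rightarrow> (nat \<Rightarrow> real) \<Rightarrow> bool" where
  "is_partition a b k p \<longleftrightarrow> p 0 = a \<and> p k = b \<and> (\<forall>i<k. p i < p (Suc i))"

definition mesh :: "nat \<Rightarrow> (nat \<Rightarrow> real) \<Rightarrow> real" where
  "mesh k p = Max (insert 0 ((\<lambda>i. p (Suc i) - p i) ` {..<k}))"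

definition tendsto_in_prob ::
    "'a measure \<Rightarrow> (nat \<Rightarrow> 'a \<Rightarrow> real) \<Rightarrow> ('a \<Rightarrow> real) \<Rightarrow> bool" where
  "tendsto_in_prob M X Y \<longleftrightarrow>
     (\<forall>e>0. (\<lambda>N. measure M {\<omega>\<in>space M. \<bar>X N \<omega> - Y \<omega>\<bar> > e}) \<longlonglongrightarrow> 0)"

text \<open>A functional acts on families of random variables modulo almost sure equality, i.e. on maps
  from the simplex to \<open>L\<^sub>m\<close>. Respecting almost sure equality on the simplex also excludes any
  dependence on values of the family outside the simplex.\<close>

definition Lm_functional ::
    "'a measure \<Rightarrow> real \<Rightarrow> real \<Rightarrow> real \<Rightarrow>
     ((real \<Rightarrow> real \<Rightarrow> 'a \<Rightarrow> real) \<Rightarrow> (real \<Rightarrow> real \<Rightarrow> 'a \<Rightarrow> real)) \<Rightarrow> bool" where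
  "Lm_functional M m S T \<Phi> \<longleftrightarrow>
     (\<forall>X Y. (\<forall>(s, t)\<in>simplex2 S T. X s t \<in> Lm_space M m \<and> Y s t \<in> Lm_space M m \<and>
                (AE \<omega> in M. X s t \<omega> = Y s t \<omega>)) \<longrightarrow>
            (\<forall>(s, t)\<in>simplex2 S T. AE \<omega> in M. \<Phi> X s t \<omega> = \<Phi> Y s t \<omega>))"

end

theory Submission
  imports Defs "HOL-Real_Asymp.Real_Asymp"
begin

text \<open>Refine \<open>[s, t]\<close> dyadically and let \<open>A\<^sup>N\<close> be the sum of \<open>A\<close> over the \<open>2\<^sup>N\<close> dyadic cells. Passing from
level \<open>n\<close> to level \<open>n + 1\<close> changes the sum by the midpoint increments of the cells of level \<open>n\<close>, so
\<open>A\<^sub>s\<^sub>,\<^sub>t - A\<^sup>N\<close> is the sum of these over all levels \<open>n < N\<close> (\<open>dyadic_sum_telescope\<close>). Each midpoint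
increment splits into its conditional expectation given the past of the midpoint, its drift, and a
rest, the noise.

On one level the noise terms are martingale differences. By a Burkholder type inequality their sum
over \<open>2\<^sup>n\<close> cells costs only a factor \<open>2\<^bsup>n/2\<^esup>\<close> in \<open>L\<^sub>m\<close>, against the gain \<open>2\<^bsup>-n(1/2+\<epsilon>)\<^esup>\<close> from the size
of the cells; the norms are summable in \<open>n\<close>. The inequality is proved from a second-order Taylor
bound for \<open>\<bar>x\<bar>\<^sup>m\<close>, whose linear term vanishes in expectation (\<open>martingale_moment\<close>).

The drift is estimated path by path by sums of \<open>h\<^sup>\<alpha> \<lambda>\<^sub>i\<^sup>\<beta>\<close>, where \<open>h = (t - s) / 2\<^sup>n\<close> and \<open>\<lambda>\<^sub>i\<close> are the
values of the control on the cells. If \<open>\<beta> \<le> 1\<close>, concavity gives the decay \<open>2\<^bsup>-n(\<alpha>+\<beta>-1)\<^esup>\<close>. If \<open>\<beta> > 1\<close>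
there need be no decay at all: for \<open>\<alpha> = 0\<close>, a control that charges a single point contributes the
same amount on every level. Here the moment bound on the increments is used a second time. At most
\<open>w\<close> cells carry more than a fraction \<open>1 / w\<close> of the control. On those cells the drift is at most
\<open>D\<^sub>n\<close>, the \<open>m\<close>-norm over the cells of all drifts of the level, and \<open>\<parallel>D\<^sub>n\<parallel>\<close> decays like \<open>2\<^bsup>-n\<epsilon>\<^esup>\<close> since
\<open>m \<ge> 2\<close>. All other cells together contribute at most \<open>w\<^bsup>-(\<beta>-1)\<^esup>\<close> times the full control term. Hence
level \<open>n\<close> costs \<open>w\<^sub>n\<^bsup>-(\<beta>-1)\<^esup>\<close> in the control term and \<open>w\<^sub>n D\<^sub>n\<close> in the remainder
(\<open>drift_level_bound\<close>).

The remainder \<open>B\<close> is therefore the sum over \<open>n\<close> of \<open>\<bar>noise\<^sub>n\<bar> + w\<^sub>n D\<^sub>n\<close> (\<open>sewing_error\<close>). It has to be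
one functional of the midpoint increments for all exponents and all controls, so the weights must
be independent of \<open>\<beta>\<close> and \<open>\<epsilon>\<close>: \<open>w\<^sub>n = 2\<^bsup>\<surd>n\<^esup>\<close> grows faster than every polynomial, which makes every
negative power of it summable, and slower than every exponential, which keeps \<open>w\<^sub>n 2\<^bsup>-n\<epsilon>\<^esup>\<close> summable.

These bounds hold almost surely, uniformly in \<open>N\<close>, so they pass to the limit in probability of
\<open>A\<^sup>N\<close>. That limit is \<open>\<A>\<^sub>t - \<A>\<^sub>s\<close>, as the dyadic partitions of \<open>[S, s]\<close> and \<open>[s, t]\<close> join to a partition of
\<open>[S, t]\<close>.\<close>

section \<open>Inequalities for powers\<close>

lemma powr_second_order_near:
  fixes a b m :: real
  assumes m: "2 \<le> m" and a: "0 < a" and b: "\<bar>b\<bar> \<le> a / 2"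
  shows "(a + b) powr m \<le> a powr m + m * a powr (m - 1) * b
           + m * (m - 1) * 2 powr (m - 2) * (a powr (m - 2) * b\<^sup>2)"
proof (cases "b = 0")
  case False
  define d :: "nat \<Rightarrow> real \<Rightarrow> real" where
    "d = (\<lambda>n x. if n = 0 then x powr m else if n = 1 then m * x powr (m - 1)
                 else m * (m - 1) * x powr (m - 2))"
  have D: "\<forall>n t. n < 2 \<and> a / 2 \<le> t \<and> t \<le> 2 * a \<longrightarrow> (d n has_real_derivative d (Suc n) t) (at t)"
  proof (intro allI impI)
    fix n :: nat and t assume nt: "n < 2 \<and> a / 2 \<le> t \<and> t \<le> 2 * a"
    then have t: "t > 0" using a by linarith
    show "(d n has_real_derivative d (Suc n) t) (at t)"
    proof (cases "n = 0")
      case True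
      then show ?thesis using t unfolding d_def by (auto intro!: derivative_eq_intros)
    next
      case False
      then have "n = 1" using nt by auto
      moreover have "m - 1 - 1 = m - 2" by simp
      ultimately show ?thesis
        using t unfolding d_def by (auto intro!: derivative_eq_intros simp: \<open>m - 1 - 1 = m - 2\<close>)
    qed
  qed
  have "d 0 = (\<lambda>x. x powr m)" by (simp add: d_def)
  have "\<exists>t. (if a + b < a then a + b < t \<and> t < a else a < t \<and> t < a + b) \<and>
      (a + b) powr m = (\<Sum>k<2. d k a / fact k * (a + b - a) ^ k) + d 2 t / fact 2 * (a + b - a) ^ 2"
    using D False a b
    by (intro Taylor[where a = "a / 2" and b = "2 * a"]) (auto simp: d_def abs_le_iff)
  then obtain t where t: "if a + b < a then a + b < t \<and> t < a else a < t \<and> t < a + b"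
    and eq: "(a + b) powr m = (\<Sum>k<2. d k a / fact k * (a + b - a) ^ k) + d 2 t / fact 2 * (a + b - a)\<^sup>2"
    by blast
  have t2: "0 \<le> t" "t \<le> 2 * a" using t a b by (auto split: if_splits simp: abs_le_iff)
  have "t powr (m - 2) \<le> (2 * a) powr (m - 2)"
    using m t2 by (intro powr_mono2) auto
  also have "\<dots> = 2 powr (m - 2) * a powr (m - 2)" using a by (simp add: powr_mult)
  finally have "m * (m - 1) * t powr (m - 2) * b\<^sup>2 \<le> m * (m - 1) * (2 powr (m - 2) * a powr (m - 2)) * b\<^sup>2"
    using m by (intro mult_right_mono mult_left_mono) auto
  moreover have "0 \<le> m * (m - 1) * t powr (m - 2) * b\<^sup>2"
    using m by auto
  moreover have "(a + b) powr m = a powr m + m * a powr (m - 1) * b + m * (m - 1) * t powr (m - 2) * b\<^sup>2 / 2"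
    using eq by (simp add: d_def lessThan_nat_numeral fact_numeral numeral_2_eq_2)
  ultimately show ?thesis by (simp add: mult.assoc)
qed simp

text \<open>This is what replaces the identity \<open>(a + b)\<^sup>2 = a\<^sup>2 + 2 a b + b\<^sup>2\<close> for exponents other than 2. Where \<open>b\<close>
is small against \<open>a\<close> it is Taylor's formula, the second derivative being comparable on \<open>[a / 2, 2 a]\<close>;
elsewhere every term is dominated by \<open>\<bar>b\<bar>\<^sup>m\<close>.\<close>

lemma powr_second_order:
  fixes m :: real
  assumes m: "2 \<le> m"
  shows "\<exists>C\<ge>1. \<forall>a b. \<bar>a + b\<bar> powr m
    \<le> \<bar>a\<bar> powr m + m * (sgn a * \<bar>a\<bar> powr (m - 1)) * b + C * (\<bar>a\<bar> powr (m - 2) * b\<^sup>2 + \<bar>b\<bar> powr m)"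
proof -
  define C1 where "C1 = m * (m - 1) * 2 powr (m - 2)"
  define C2 where "C2 = 3 powr m + m * 2 powr (m - 1)"
  define C where "C = max 1 (C1 + C2)"
  have C1: "0 \<le> C1" and C2: "0 \<le> C2" using m by (auto simp: C1_def C2_def)
  have pos: "\<bar>a + b\<bar> powr m \<le> \<bar>a\<bar> powr m + m * (sgn a * \<bar>a\<bar> powr (m - 1)) * b
               + C * (\<bar>a\<bar> powr (m - 2) * b\<^sup>2 + \<bar>b\<bar> powr m)" if a: "0 \<le> a" for a b
  proof (cases "\<bar>b\<bar> \<le> a / 2 \<and> 0 < a")
    case True
    then have ab: "0 \<le> a + b" by (auto simp: abs_le_iff)
    have "C1 * (a powr (m - 2) * b\<^sup>2) \<le> C * (a powr (m - 2) * b\<^sup>2 + \<bar>b\<bar> powr m)"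
      using C2 C1 by (intro mult_mono) (auto simp: C_def)
    with powr_second_order_near[OF m, of a b] True ab show ?thesis
      by (simp add: C1_def)
  next
    case False
    have b: "a \<le> 2 * \<bar>b\<bar>"
    proof (cases "a = 0")
      case True then show ?thesis by simp
    next
      case F2: False
      then have "0 < a" using a by simp
      then have "\<not> \<bar>b\<bar> \<le> a / 2" using False by blast
      then show ?thesis by linarith
    qed
    have "\<bar>a + b\<bar> powr m \<le> (3 * \<bar>b\<bar>) powr m"
      using b a m by (intro powr_mono2) auto
    also have "\<dots> = 3 powr m * \<bar>b\<bar> powr m" by (simp add: powr_mult)
    finally have 1: "\<bar>a + b\<bar> powr m \<le> 3 powr m * \<bar>b\<bar> powr m" .
    have "a powr (m - 1) * \<bar>b\<bar> \<le> (2 * \<bar>b\<bar>) powr (m - 1) * \<bar>b\<bar>"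
      using a b m by (intro mult_right_mono powr_mono2) auto
    also have "\<dots> = 2 powr (m - 1) * (\<bar>b\<bar> powr (m - 1) * \<bar>b\<bar> powr 1)" by (simp add: powr_mult)
    also have "\<dots> = 2 powr (m - 1) * \<bar>b\<bar> powr m" by (simp only: powr_add[symmetric]) simp
    finally have 2: "m * (a powr (m - 1) * \<bar>b\<bar>) \<le> m * (2 powr (m - 1) * \<bar>b\<bar> powr m)"
      using m by (intro mult_left_mono) auto
    have "\<bar>m * (sgn a * \<bar>a\<bar> powr (m - 1)) * b\<bar> \<le> m * (a powr (m - 1) * \<bar>b\<bar>)"
      using m a by (auto simp: abs_mult sgn_if)
    with 2 have 3: "- (m * (sgn a * \<bar>a\<bar> powr (m - 1)) * b) \<le> m * 2 powr (m - 1) * \<bar>b\<bar> powr m"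
      by (simp add: abs_le_iff mult.assoc)
    have "C2 * \<bar>b\<bar> powr m \<le> C * (\<bar>a\<bar> powr (m - 2) * b\<^sup>2 + \<bar>b\<bar> powr m)"
      using C1 C2 by (intro mult_mono) (auto simp: C_def)
    moreover have "C2 * \<bar>b\<bar> powr m = 3 powr m * \<bar>b\<bar> powr m + m * 2 powr (m - 1) * \<bar>b\<bar> powr m"
      by (simp add: C2_def algebra_simps)
    moreover have "0 \<le> \<bar>a\<bar> powr m" by simp
    ultimately show ?thesis using 1 3 by linarith
  qed
  have "\<bar>a + b\<bar> powr m \<le> \<bar>a\<bar> powr m + m * (sgn a * \<bar>a\<bar> powr (m - 1)) * b
               + C * (\<bar>a\<bar> powr (m - 2) * b\<^sup>2 + \<bar>b\<bar> powr m)" for a b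
  proof (cases "0 \<le> a")
    case False
    have "\<bar>- a + - b\<bar> = \<bar>a + b\<bar>" by linarith
    with pos[of "-a" "-b"] False show ?thesis by simp
  qed (rule pos)
  moreover have "C \<ge> 1" by (simp add: C_def)
  ultimately show ?thesis by blast
qed

lemma convex_on_abs_powr:
  fixes m :: real
  assumes m: "1 \<le> m"
  shows "convex_on UNIV (\<lambda>x::real. \<bar>x\<bar> powr m)"
proof (rule convex_onI)
  fix t x y :: real assume t: "0 < t" "t < 1"
  have "\<bar>(1 - t) *\<^sub>R x + t *\<^sub>R y\<bar> \<le> (1 - t) * \<bar>x\<bar> + t * \<bar>y\<bar>"
    using t abs_triangle_ineq[of "(1 - t) * x" "t * y"] by (simp add: abs_mult)
  then have "\<bar>(1 - t) *\<^sub>R x + t *\<^sub>R y\<bar> powr m \<le> ((1 - t) * \<bar>x\<bar> + t * \<bar>y\<bar>) powr m"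
    using m by (intro powr_mono2) auto
  also have "\<dots> \<le> (1 - t) * \<bar>x\<bar> powr m + t * \<bar>y\<bar> powr m"
  proof -
    have le: "r powr m \<le> r" if "0 < r" "r < 1" for r :: real
      using powr_mono'[of 1 m r] that m by simp
    consider "x = 0" | "y = 0" | "\<bar>x\<bar> \<in> {0<..}" "\<bar>y\<bar> \<in> {0<..}" by auto
    then show ?thesis
    proof cases
      case 1
      then show ?thesis using t le[of t] by (simp add: powr_mult mult_right_mono)
    next
      case 2
      then show ?thesis using t le[of "1 - t"] by (simp add: powr_mult mult_right_mono)
    next
      case 3
      then show ?thesis
        using convex_onD[OF powr_convex[OF m], of t "\<bar>x\<bar>" "\<bar>y\<bar>"] t by simp
    qed
  qed
  finally show "\<bar>(1 - t) *\<^sub>R x + t *\<^sub>R y\<bar> powr m \<le> (1 - t) * \<bar>x\<bar> powr m + t * \<bar>y\<bar> powr m" .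
qed simp

text \<open>Jensen's inequality for the probability weights \<open>c\<^sub>i / \<Sum> c\<close> at the points \<open>(\<Sum> c) f\<^sub>i / c\<^sub>i\<close>. With \<open>c\<^sub>i\<close>
proportional to bounds on the \<open>L\<^sub>m\<close> norms of the \<open>f\<^sub>i\<close>, integration turns it into Minkowski's
inequality.\<close>

lemma powr_sum_weighted:
  fixes m :: real and f c :: "'i \<Rightarrow> real"
  assumes m: "1 \<le> m" and fin: "finite I" and c: "\<And>i. i \<in> I \<Longrightarrow> 0 < c i"
  shows "\<bar>\<Sum>i\<in>I. f i\<bar> powr m \<le> (\<Sum>i\<in>I. c i) powr (m - 1) * (\<Sum>i\<in>I. c i powr (1 - m) * \<bar>f i\<bar> powr m)"
proof (cases "I = {}")
  case False
  define s where "s = (\<Sum>i\<in>I. c i)"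
  have s: "0 < s" unfolding s_def using fin False c by (intro sum_pos) auto
  have "\<bar>\<Sum>i\<in>I. (c i / s) *\<^sub>R (s * f i / c i)\<bar> powr m \<le> (\<Sum>i\<in>I. (c i / s) * \<bar>s * f i / c i\<bar> powr m)"
    using c s by (intro convex_on_sum[OF fin False convex_on_abs_powr[OF m]])
      (auto simp: sum_divide_distrib[symmetric] s_def[symmetric] less_imp_le)
  also have "(\<Sum>i\<in>I. (c i / s) *\<^sub>R (s * f i / c i)) = (\<Sum>i\<in>I. f i)"
  proof (rule sum.cong[OF refl])
    fix i assume "i \<in> I"
    then have "0 < c i" by (rule c)
    then show "(c i / s) *\<^sub>R (s * f i / c i) = f i" using s by simp
  qed
  also have "(\<Sum>i\<in>I. (c i / s) * \<bar>s * f i / c i\<bar> powr m)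
      = (\<Sum>i\<in>I. s powr (m - 1) * (c i powr (1 - m) * \<bar>f i\<bar> powr m))"
  proof (rule sum.cong[OF refl])
    fix i assume "i \<in> I"
    then have ci: "0 < c i" using c by auto
    have "\<bar>s * f i / c i\<bar> powr m = s powr m * \<bar>f i\<bar> powr m / c i powr m"
      using ci s by (simp add: abs_mult powr_mult powr_divide)
    then show "(c i / s) * \<bar>s * f i / c i\<bar> powr m = s powr (m - 1) * (c i powr (1 - m) * \<bar>f i\<bar> powr m)"
      using ci s by (simp add: powr_diff)
  qed
  finally show ?thesis by (simp add: s_def sum_distrib_left)
qed simp

lemma powr_sum_le:
  fixes m :: real and f :: "'i \<Rightarrow> real"
  assumes m: "1 \<le> m" and fin: "finite I"
  shows "\<bar>\<Sum>i\<in>I. f i\<bar> powr m \<le> real (card I) powr (m - 1) * (\<Sum>i\<in>I. \<bar>f i\<bar> powr m)"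
  using powr_sum_weighted[OF m fin, of "\<lambda>_. 1" f] by simp

lemma abs_add_powr_le:
  fixes m a b :: real
  assumes m: "1 \<le> m"
  shows "\<bar>a + b\<bar> powr m \<le> 2 powr (m - 1) * (\<bar>a\<bar> powr m + \<bar>b\<bar> powr m)"
  using powr_sum_le[OF m, of "{True, False}" "\<lambda>i. if i then a else b"] by simp

section \<open>Moments of sums and series\<close>

lemma (in prob_space) integrable_if_moment:
  fixes f :: "'a \<Rightarrow> real"
  assumes "1 \<le> m" and [measurable]: "f \<in> borel_measurable M" and "integrable M (\<lambda>\<omega>. \<bar>f \<omega>\<bar> powr m)"
  shows "integrable M f"
proof (rule Bochner_Integration.integrable_bound)
  show "integrable M (\<lambda>\<omega>. 1 + \<bar>f \<omega>\<bar> powr m)" using assms by auto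
  have "\<bar>x\<bar> \<le> 1 + \<bar>x\<bar> powr m" for x :: real
  proof (cases "\<bar>x\<bar> \<le> 1")
    case True
    then show ?thesis using powr_ge_zero[of "\<bar>x\<bar>" m] by linarith
  next
    case False
    then show ?thesis using powr_mono[of 1 m "\<bar>x\<bar>"] assms by simp
  qed
  then show "AE \<omega> in M. norm (f \<omega>) \<le> norm (1 + \<bar>f \<omega>\<bar> powr m)"
    by (intro AE_I2) auto
qed simp

lemma integrable_moment_sum:
  fixes f :: "'i \<Rightarrow> 'a \<Rightarrow> real"
  assumes m: "1 \<le> m" and fin: "finite I"
    and [measurable]: "\<And>i. i \<in> I \<Longrightarrow> f i \<in> borel_measurable M"
    and int: "\<And>i. i \<in> I \<Longrightarrow> integrable M (\<lambda>\<omega>. \<bar>f i \<omega>\<bar> powr m)"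
  shows "integrable M (\<lambda>\<omega>. \<bar>\<Sum>i\<in>I. f i \<omega>\<bar> powr m)"
proof (rule Bochner_Integration.integrable_bound)
  show "integrable M (\<lambda>\<omega>. real (card I) powr (m - 1) * (\<Sum>i\<in>I. \<bar>f i \<omega>\<bar> powr m))"
    using int by auto
  show "AE \<omega> in M. norm (\<bar>\<Sum>i\<in>I. f i \<omega>\<bar> powr m)
      \<le> norm (real (card I) powr (m - 1) * (\<Sum>i\<in>I. \<bar>f i \<omega>\<bar> powr m))"
    using powr_sum_le[OF m fin] by (intro AE_I2) (simp add: abs_mult sum_nonneg)
qed measurable

lemma moment_add:
  fixes f g :: "'a \<Rightarrow> real"
  assumes m: "1 \<le> m" and [measurable]: "f \<in> borel_measurable M" "g \<in> borel_measurable M"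
    and f: "integrable M (\<lambda>\<omega>. \<bar>f \<omega>\<bar> powr m)" and g: "integrable M (\<lambda>\<omega>. \<bar>g \<omega>\<bar> powr m)"
  shows "integrable M (\<lambda>\<omega>. \<bar>f \<omega> + g \<omega>\<bar> powr m)"
    and "(\<integral>\<omega>. \<bar>f \<omega> + g \<omega>\<bar> powr m \<partial>M)
       \<le> 2 powr (m - 1) * ((\<integral>\<omega>. \<bar>f \<omega>\<bar> powr m \<partial>M) + (\<integral>\<omega>. \<bar>g \<omega>\<bar> powr m \<partial>M))"
proof -
  have i: "integrable M (\<lambda>\<omega>. 2 powr (m - 1) * (\<bar>f \<omega>\<bar> powr m + \<bar>g \<omega>\<bar> powr m))"
    using f g by auto
  show 1: "integrable M (\<lambda>\<omega>. \<bar>f \<omega> + g \<omega>\<bar> powr m)"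
    by (rule Bochner_Integration.integrable_bound[OF i])
      (auto intro!: AE_I2 abs_add_powr_le[OF m] simp: abs_mult)
  show "(\<integral>\<omega>. \<bar>f \<omega> + g \<omega>\<bar> powr m \<partial>M)
       \<le> 2 powr (m - 1) * ((\<integral>\<omega>. \<bar>f \<omega>\<bar> powr m \<partial>M) + (\<integral>\<omega>. \<bar>g \<omega>\<bar> powr m \<partial>M))"
    using integral_mono[OF 1 i abs_add_powr_le[OF m]] f g by simp
qed

text \<open>Minkowski's inequality for series: the partial sums are bounded in \<open>L\<^sub>m\<close> by \<open>powr_sum_weighted\<close> with
the weights \<open>c\<close>, and monotone convergence gives both almost sure summability and the bound for the
limit.\<close>

lemma moment_suminf:
  fixes f :: "nat \<Rightarrow> 'a \<Rightarrow> real"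
  assumes m: "1 \<le> m" and R: "0 \<le> R" and c: "\<And>n. 0 < c n" and sc: "summable c"
    and [measurable]: "\<And>n. f n \<in> borel_measurable M"
    and f0: "\<And>n \<omega>. 0 \<le> f n \<omega>"
    and int: "\<And>n. integrable M (\<lambda>\<omega>. \<bar>f n \<omega>\<bar> powr m)"
    and le: "\<And>n. (\<integral>\<omega>. \<bar>f n \<omega>\<bar> powr m \<partial>M) \<le> (c n * R) powr m"
  shows "AE \<omega> in M. summable (\<lambda>n. f n \<omega>)"
    and "integrable M (\<lambda>\<omega>. \<bar>\<Sum>n. f n \<omega>\<bar> powr m)"
    and "(\<integral>\<omega>. \<bar>\<Sum>n. f n \<omega>\<bar> powr m \<partial>M) \<le> (suminf c * R) powr m"
proof -
  define P where "P N \<omega> = (\<Sum>n<N. f n \<omega>)" for N \<omega>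
  have [measurable]: "P N \<in> borel_measurable M" for N unfolding P_def by measurable
  have P0: "0 \<le> P N \<omega>" for N \<omega> unfolding P_def by (intro sum_nonneg f0)
  have Pmono: "P N \<omega> \<le> P N' \<omega>" if "N \<le> N'" for N N' \<omega>
    unfolding P_def using that f0 by (intro sum_mono2) auto
  have intP: "integrable M (\<lambda>\<omega>. P N \<omega> powr m)" for N
    using integrable_moment_sum[OF m, of "{..<N}" f M] int P0 by (simp add: P_def)
  have bound: "(\<integral>\<omega>. P N \<omega> powr m \<partial>M) \<le> (suminf c * R) powr m" for N
  proof -
    have "(\<integral>\<omega>. P N \<omega> powr m \<partial>M)
        \<le> (\<integral>\<omega>. (\<Sum>n<N. c n) powr (m - 1) * (\<Sum>n<N. c n powr (1 - m) * \<bar>f n \<omega>\<bar> powr m) \<partial>M)"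
    proof (rule integral_mono[OF intP])
      show "integrable M (\<lambda>\<omega>. (\<Sum>n<N. c n) powr (m - 1) * (\<Sum>n<N. c n powr (1 - m) * \<bar>f n \<omega>\<bar> powr m))"
        using int by auto
      show "P N \<omega> powr m \<le> (\<Sum>n<N. c n) powr (m - 1) * (\<Sum>n<N. c n powr (1 - m) * \<bar>f n \<omega>\<bar> powr m)" for \<omega>
        using powr_sum_weighted[OF m, of "{..<N}" c "\<lambda>n. f n \<omega>"] c P0[of N \<omega>] by (simp add: P_def)
    qed
    also have "\<dots> = (\<Sum>n<N. c n) powr (m - 1) * (\<Sum>n<N. c n powr (1 - m) * (\<integral>\<omega>. \<bar>f n \<omega>\<bar> powr m \<partial>M))"
      using int by simp
    also have "\<dots> \<le> (\<Sum>n<N. c n) powr (m - 1) * (\<Sum>n<N. c n powr (1 - m) * (c n * R) powr m)"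
      by (intro mult_left_mono sum_mono le) auto
    also have "(\<Sum>n<N. c n powr (1 - m) * (c n * R) powr m) = (\<Sum>n<N. c n) * R powr m"
    proof -
      have "c n powr (1 - m) * (c n * R) powr m = c n * R powr m" for n
        using c[of n] R by (simp add: powr_mult powr_diff)
      then show ?thesis by (simp add: sum_distrib_right)
    qed
    also have "(\<Sum>n<N. c n) powr (m - 1) * ((\<Sum>n<N. c n) * R powr m) = ((\<Sum>n<N. c n) * R) powr m"
    proof (cases N)
      case (Suc k)
      then have "0 < (\<Sum>n<N. c n)" using c by (intro sum_pos) auto
      then show ?thesis using R by (simp add: powr_mult powr_diff)
    qed simp
    also have "\<dots> \<le> (suminf c * R) powr m"
      using c m R sc by (intro powr_mono2 mult_right_mono sum_le_suminf mult_nonneg_nonneg sum_nonneg)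
        (auto simp: less_imp_le)
    finally show ?thesis .
  qed
  define G where "G \<omega> = (SUP N. ennreal (P N \<omega> powr m))" for \<omega>
  have [measurable]: "G \<in> borel_measurable M" unfolding G_def by measurable
  have "(\<integral>\<^sup>+\<omega>. G \<omega> \<partial>M) = (SUP N. (\<integral>\<^sup>+\<omega>. ennreal (P N \<omega> powr m) \<partial>M))"
    unfolding G_def using m P0 Pmono
    by (intro nn_integral_monotone_convergence_SUP) (auto simp: incseq_def le_fun_def intro!: ennreal_leI powr_mono2)
  also have "\<dots> \<le> ennreal ((suminf c * R) powr m)"
    using intP bound by (intro SUP_least) (simp add: nn_integral_eq_integral ennreal_leI)
  finally have G: "(\<integral>\<^sup>+\<omega>. G \<omega> \<partial>M) \<le> ennreal ((suminf c * R) powr m)" .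
  have "AE \<omega> in M. G \<omega> \<noteq> \<infinity>"
    using G by (intro nn_integral_noteq_infinite) (auto simp: top_unique)
  then have key: "AE \<omega> in M. summable (\<lambda>n. f n \<omega>) \<and> ennreal (\<bar>\<Sum>n. f n \<omega>\<bar> powr m) \<le> G \<omega>"
  proof eventually_elim
    case (elim \<omega>)
    then obtain r where r: "G \<omega> = ennreal r" "0 \<le> r" by (cases "G \<omega>") auto
    have Pr: "P N \<omega> powr m \<le> r" for N
    proof -
      have "ennreal (P N \<omega> powr m) \<le> ennreal r"
        unfolding r(1)[symmetric] G_def by (rule SUP_upper) simp
      then show ?thesis using r by simp
    qed
    have "P N \<omega> \<le> r powr (1 / m)" for N
    proof -
      have "P N \<omega> = (P N \<omega> powr m) powr (1 / m)" using m P0[of N \<omega>] by (simp add: powr_powr)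
      also have "\<dots> \<le> r powr (1 / m)" using m Pr by (intro powr_mono2) auto
      finally show ?thesis .
    qed
    then have s: "summable (\<lambda>n. f n \<omega>)"
      using f0 unfolding P_def by (intro summableI_nonneg_bounded) auto
    then have "(\<lambda>N. P N \<omega>) \<longlonglongrightarrow> (\<Sum>n. f n \<omega>)" unfolding P_def by (rule summable_LIMSEQ)
    then have "(\<lambda>N. P N \<omega> powr m) \<longlonglongrightarrow> (\<Sum>n. f n \<omega>) powr m"
      using m P0 by (intro tendsto_powr') auto
    then have "(\<Sum>n. f n \<omega>) powr m \<le> r" using Pr by (intro LIMSEQ_le_const2) auto
    moreover have "0 \<le> (\<Sum>n. f n \<omega>)" using s f0 by (intro suminf_nonneg) auto
    ultimately show ?case using s r by (simp add: ennreal_leI)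
  qed
  then show "AE \<omega> in M. summable (\<lambda>n. f n \<omega>)" by auto
  have nn: "(\<integral>\<^sup>+\<omega>. ennreal (\<bar>\<Sum>n. f n \<omega>\<bar> powr m) \<partial>M) \<le> ennreal ((suminf c * R) powr m)"
    using key G by (intro order_trans[OF nn_integral_mono_AE G]) auto
  show i: "integrable M (\<lambda>\<omega>. \<bar>\<Sum>n. f n \<omega>\<bar> powr m)"
    using nn by (intro integrableI_bounded) (auto intro: le_less_trans)
  show "(\<integral>\<omega>. \<bar>\<Sum>n. f n \<omega>\<bar> powr m \<partial>M) \<le> (suminf c * R) powr m"
    using nn i by (simp add: nn_integral_eq_integral)
qed

lemma powr_interpolate_sq:
  fixes a b m :: real
  assumes m: "2 \<le> m" and "0 \<le> a" "0 \<le> b"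
  shows "a powr (m - 2) * b\<^sup>2 \<le> a powr m + b powr m"
proof -
  have split: "x powr m = x powr (m - 2) * x\<^sup>2" if "0 \<le> x" for x :: real
    using that m by (cases "x = 0") (auto simp: powr_diff)
  show ?thesis
  proof (cases "a \<le> b")
    case True
    then have "a powr (m - 2) * b\<^sup>2 \<le> b powr (m - 2) * b\<^sup>2"
      using assms by (intro mult_right_mono powr_mono2) auto
    then show ?thesis using split[of b] assms by (simp add: add_increasing)
  next
    case False
    then have "a powr (m - 2) * b\<^sup>2 \<le> a powr (m - 2) * a\<^sup>2"
      using assms by (intro mult_left_mono power_mono) auto
    then show ?thesis using split[of a] assms by (simp add: add_increasing2)
  qed
qed

lemma powr_interpolate_one:
  fixes a b m :: real
  assumes m: "1 \<le> m" and "0 \<le> a" "0 \<le> b"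
  shows "a powr (m - 1) * b \<le> a powr m + b powr m"
proof -
  have split: "x powr m = x powr (m - 1) * x" if "0 \<le> x" for x :: real
    using that m by (cases "x = 0") (auto simp: powr_diff)
  show ?thesis
  proof (cases "a \<le> b")
    case True
    then have "a powr (m - 1) * b \<le> b powr (m - 1) * b"
      using assms by (intro mult_right_mono powr_mono2) auto
    then show ?thesis using split[of b] assms by (simp add: add_increasing)
  next
    case False
    then have "a powr (m - 1) * b \<le> a powr (m - 1) * a"
      using assms by (intro mult_left_mono) auto
    then show ?thesis using split[of a] assms by (simp add: add_increasing2)
  qed
qed

section \<open>Moments of martingale sums\<close>

lemma (in prob_space) sigma_finite_subalgebraI:
  assumes "subalgebra M G"
  shows "sigma_finite_subalgebra M G"
proof -
  interpret finite_measure_subalgebra M G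
    by unfold_locales (rule assms)
  show ?thesis by (rule sigma_finite_subalgebra_axioms)
qed

lemma (in prob_space) cond_exp_moment:
  fixes f :: "'a \<Rightarrow> real"
  assumes G: "subalgebra M G" and m: "1 \<le> m"
    and f[measurable]: "f \<in> borel_measurable M" and int: "integrable M (\<lambda>\<omega>. \<bar>f \<omega>\<bar> powr m)"
  shows "integrable M (\<lambda>\<omega>. \<bar>real_cond_exp M G f \<omega>\<bar> powr m)"
    and "(\<integral>\<omega>. \<bar>real_cond_exp M G f \<omega>\<bar> powr m \<partial>M) \<le> (\<integral>\<omega>. \<bar>f \<omega>\<bar> powr m \<partial>M)"
proof -
  interpret sigma_finite_subalgebra M G by (rule sigma_finite_subalgebraI[OF G])
  let ?g = "real_cond_exp M G (\<lambda>\<omega>. \<bar>f \<omega>\<bar> powr m)"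
  have le: "AE \<omega> in M. \<bar>real_cond_exp M G f \<omega>\<bar> powr m \<le> ?g \<omega>"
    by (rule real_cond_exp_jensens_inequality(2)[where I = UNIV])
      (auto intro: integrable_if_moment[OF m f int] int convex_on_abs_powr[OF m])
  have g: "integrable M ?g" using int by (rule real_cond_exp_int)
  show 1: "integrable M (\<lambda>\<omega>. \<bar>real_cond_exp M G f \<omega>\<bar> powr m)"
    by (rule Bochner_Integration.integrable_bound[OF g]) (use le in auto)
  show "(\<integral>\<omega>. \<bar>real_cond_exp M G f \<omega>\<bar> powr m \<partial>M) \<le> (\<integral>\<omega>. \<bar>f \<omega>\<bar> powr m \<partial>M)"
    using integral_mono_AE[OF 1 g le] real_cond_exp_int(2)[OF int] by simp
qed

text \<open>The linear Taylor term is the product of \<open>Y\<close> with a \<open>G\<close>-measurable variable and so integrates to zero.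
The mixed term \<open>\<bar>U\<bar>\<^bsup>m-2\<^esup> Y\<^sup>2\<close> is bounded after normalising by \<open>R\<close> and \<open>c\<close>: \<open>x\<^bsup>m-2\<^esup> y\<^sup>2 \<le> x\<^sup>m + y\<^sup>m\<close> is then
as good as Hoelder's inequality.\<close>

lemma (in prob_space) martingale_moment_step:
  fixes U Y :: "'a \<Rightarrow> real"
  assumes m: "2 \<le> m" and C: "0 \<le> C"
    and taylor: "\<And>a b. \<bar>a + b\<bar> powr m
       \<le> \<bar>a\<bar> powr m + m * (sgn a * \<bar>a\<bar> powr (m - 1)) * b + C * (\<bar>a\<bar> powr (m - 2) * b\<^sup>2 + \<bar>b\<bar> powr m)"
    and G: "subalgebra M G" and U: "U \<in> borel_measurable G"
    and Y[measurable]: "Y \<in> borel_measurable M"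
    and Y0: "AE \<omega> in M. real_cond_exp M G Y \<omega> = 0"
    and Um: "integrable M (\<lambda>\<omega>. \<bar>U \<omega>\<bar> powr m)" and Ym: "integrable M (\<lambda>\<omega>. \<bar>Y \<omega>\<bar> powr m)"
    and R: "0 < R" and c: "0 < c"
    and UR: "(\<integral>\<omega>. \<bar>U \<omega>\<bar> powr m \<partial>M) \<le> R powr m" and Yc: "(\<integral>\<omega>. \<bar>Y \<omega>\<bar> powr m \<partial>M) \<le> c powr m"
  shows "(\<integral>\<omega>. \<bar>U \<omega> + Y \<omega>\<bar> powr m \<partial>M) \<le> R powr m + C * (2 * R powr (m - 2) * c\<^sup>2 + c powr m)"
proof -
  interpret sigma_finite_subalgebra M G by (rule sigma_finite_subalgebraI[OF G])
  have [measurable]: "U \<in> borel_measurable M" by (rule measurable_from_subalg[OF G U])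
  define g where "g \<omega> = sgn (U \<omega>) * \<bar>U \<omega>\<bar> powr (m - 1)" for \<omega>
  have gG[measurable]: "g \<in> borel_measurable G" using U unfolding g_def by measurable
  have [measurable]: "g \<in> borel_measurable M" by (rule measurable_from_subalg[OF G gG])
  have gY: "integrable M (\<lambda>\<omega>. g \<omega> * Y \<omega>)"
  proof (rule Bochner_Integration.integrable_bound)
    show "integrable M (\<lambda>\<omega>. \<bar>U \<omega>\<bar> powr m + \<bar>Y \<omega>\<bar> powr m)" using Um Ym by auto
    show "AE \<omega> in M. norm (g \<omega> * Y \<omega>) \<le> norm (\<bar>U \<omega>\<bar> powr m + \<bar>Y \<omega>\<bar> powr m)"
    proof (rule AE_I2)
      fix \<omega>
      have "norm (g \<omega> * Y \<omega>) \<le> \<bar>U \<omega>\<bar> powr (m - 1) * \<bar>Y \<omega>\<bar>"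
        by (auto simp: g_def abs_mult sgn_if)
      also have "\<dots> \<le> \<bar>U \<omega>\<bar> powr m + \<bar>Y \<omega>\<bar> powr m"
        using m by (intro powr_interpolate_one) auto
      finally show "norm (g \<omega> * Y \<omega>) \<le> norm (\<bar>U \<omega>\<bar> powr m + \<bar>Y \<omega>\<bar> powr m)" by simp
    qed
  qed measurable
  have "(\<integral>\<omega>. g \<omega> * Y \<omega> \<partial>M) = (\<integral>\<omega>. g \<omega> * real_cond_exp M G Y \<omega> \<partial>M)"
    by (rule real_cond_exp_intg(2)[symmetric, OF gY gG Y])
  also have "\<dots> = (\<integral>\<omega>. 0 \<partial>M)"
    using Y0 by (intro integral_cong_AE) auto
  finally have orth: "(\<integral>\<omega>. g \<omega> * Y \<omega> \<partial>M) = 0" by simp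
  \<comment> \<open>Normalising \<open>U\<close> by \<open>R\<close> and \<open>Y\<close> by \<open>c\<close> makes both \<open>m\<close>-th moments at most 1.\<close>
  define K where "K = R powr (m - 2) * c\<^sup>2"
  have K: "0 \<le> K" by (simp add: K_def)
  have quad: "\<bar>U \<omega>\<bar> powr (m - 2) * (Y \<omega>)\<^sup>2 \<le> K * (\<bar>U \<omega>\<bar> powr m / R powr m + \<bar>Y \<omega>\<bar> powr m / c powr m)" for \<omega>
  proof -
    have "\<bar>U \<omega>\<bar> powr (m - 2) * (Y \<omega>)\<^sup>2 = K * ((\<bar>U \<omega>\<bar> / R) powr (m - 2) * (\<bar>Y \<omega>\<bar> / c)\<^sup>2)"
      using R c by (simp add: K_def powr_divide power_divide)
    also have "\<dots> \<le> K * ((\<bar>U \<omega>\<bar> / R) powr m + (\<bar>Y \<omega>\<bar> / c) powr m)"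
      using R c by (intro mult_left_mono[OF powr_interpolate_sq[OF m] K]) auto
    finally show ?thesis using R c by (simp add: powr_divide)
  qed
  define h where "h \<omega> = \<bar>U \<omega>\<bar> powr m + m * (g \<omega> * Y \<omega>)
     + C * (K * (\<bar>U \<omega>\<bar> powr m / R powr m + \<bar>Y \<omega>\<bar> powr m / c powr m) + \<bar>Y \<omega>\<bar> powr m)" for \<omega>
  have hi: "integrable M h" unfolding h_def using gY Um Ym by auto
  have "(\<integral>\<omega>. \<bar>U \<omega> + Y \<omega>\<bar> powr m \<partial>M) \<le> (\<integral>\<omega>. h \<omega> \<partial>M)"
  proof (rule integral_mono[OF _ hi])
    show "integrable M (\<lambda>\<omega>. \<bar>U \<omega> + Y \<omega>\<bar> powr m)"
      using m Um Ym by (intro moment_add) auto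
    show "\<bar>U \<omega> + Y \<omega>\<bar> powr m \<le> h \<omega>" for \<omega>
    proof -
      have "C * (\<bar>U \<omega>\<bar> powr (m - 2) * (Y \<omega>)\<^sup>2 + \<bar>Y \<omega>\<bar> powr m)
         \<le> C * (K * (\<bar>U \<omega>\<bar> powr m / R powr m + \<bar>Y \<omega>\<bar> powr m / c powr m) + \<bar>Y \<omega>\<bar> powr m)"
        by (intro mult_left_mono C add_right_mono quad)
      with taylor[of "U \<omega>" "Y \<omega>"] show ?thesis by (simp add: h_def g_def mult.assoc)
    qed
  qed
  also have "(\<integral>\<omega>. h \<omega> \<partial>M) = (\<integral>\<omega>. \<bar>U \<omega>\<bar> powr m \<partial>M)
     + C * (K * ((\<integral>\<omega>. \<bar>U \<omega>\<bar> powr m \<partial>M) / R powr m + (\<integral>\<omega>. \<bar>Y \<omega>\<bar> powr m \<partial>M) / c powr m) + (\<integral>\<omega>. \<bar>Y \<omega>\<bar> powr m \<partial>M))"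
    unfolding h_def using gY Um Ym orth by simp
  also have "\<dots> \<le> R powr m + C * (K * (1 + 1) + c powr m)"
    using UR Yc R c by (intro add_mono mult_left_mono C K) (auto simp: divide_le_eq)
  finally show ?thesis by (simp add: K_def mult_ac)
qed

text \<open>Induction on the number of terms. The square root growth reproduces itself because, with
\<open>x = 3 C k\<close> and \<open>p = m / 2\<close>, the step adds at most \<open>3 C x\<^bsup>p-1\<^esup>\<close> to \<open>x\<^sup>p\<close>, and
\<open>(x + 3 C) x\<^bsup>p-1\<^esup> \<le> (x + 3 C)\<^sup>p\<close>. Positivity of \<open>c\<close> is what the normalisation in the step needs.\<close>

lemma (in prob_space) martingale_moment_pos:
  fixes Y :: "nat \<Rightarrow> 'a \<Rightarrow> real"
  assumes m: "2 \<le> m" and C: "1 \<le> C"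
    and taylor: "\<And>a b. \<bar>a + b\<bar> powr m
       \<le> \<bar>a\<bar> powr m + m * (sgn a * \<bar>a\<bar> powr (m - 1)) * b + C * (\<bar>a\<bar> powr (m - 2) * b\<^sup>2 + \<bar>b\<bar> powr m)"
    and G: "\<And>i. i < N \<Longrightarrow> subalgebra M (G i)"
    and adapted: "\<And>i j. j < i \<Longrightarrow> i < N \<Longrightarrow> Y j \<in> borel_measurable (G i)"
    and Y: "\<And>i. i < N \<Longrightarrow> Y i \<in> borel_measurable M"
    and Y0: "\<And>i. i < N \<Longrightarrow> AE \<omega> in M. real_cond_exp M (G i) (Y i) \<omega> = 0"
    and Ym: "\<And>i. i < N \<Longrightarrow> integrable M (\<lambda>\<omega>. \<bar>Y i \<omega>\<bar> powr m)"
    and c: "0 < c" and Yc: "\<And>i. i < N \<Longrightarrow> (\<integral>\<omega>. \<bar>Y i \<omega>\<bar> powr m \<partial>M) \<le> c powr m"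
  shows "(\<integral>\<omega>. \<bar>\<Sum>i<N. Y i \<omega>\<bar> powr m \<partial>M) \<le> (sqrt (3 * C * real N) * c) powr m"
proof -
  have "k \<le> N \<Longrightarrow> (\<integral>\<omega>. \<bar>\<Sum>i<k. Y i \<omega>\<bar> powr m \<partial>M) \<le> (sqrt (3 * C * real k) * c) powr m" for k
  proof (induction k)
    case (Suc k)
    then have k: "k < N" and IH: "(\<integral>\<omega>. \<bar>\<Sum>i<k. Y i \<omega>\<bar> powr m \<partial>M) \<le> (sqrt (3 * C * real k) * c) powr m" by auto
    show ?case
    proof (cases "k = 0")
      case True
      have "c powr m \<le> (sqrt (3 * C) * c) powr m"
        using c C m by (intro powr_mono2) auto
      then show ?thesis using True Yc[OF k] by simp
    next
      case False
      define R where "R = sqrt (3 * C * real k) * c"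
      have R: "0 < R" using False C c by (simp add: R_def)
      have U: "(\<lambda>\<omega>. \<Sum>i<k. Y i \<omega>) \<in> borel_measurable (G k)"
        using adapted k by (intro borel_measurable_sum) auto
      have Um: "integrable M (\<lambda>\<omega>. \<bar>\<Sum>i<k. Y i \<omega>\<bar> powr m)"
        using m k Y Ym by (intro integrable_moment_sum) auto
      have "(\<integral>\<omega>. \<bar>(\<Sum>i<k. Y i \<omega>) + Y k \<omega>\<bar> powr m \<partial>M)
         \<le> R powr m + C * (2 * R powr (m - 2) * c\<^sup>2 + c powr m)"
        using C R c IH k unfolding R_def[symmetric]
        by (intro martingale_moment_step[OF m _ taylor G U Y Y0 Um Ym]) (auto intro: Yc)
      also have "\<dots> \<le> (sqrt (3 * C * real (Suc k)) * c) powr m"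
      proof -
        define p where "p = m / 2"
        have p: "1 \<le> p" using m by (simp add: p_def)
        define x where "x = 3 * C * real k"
        have sq: "(sqrt y * c) powr r = y powr (r / 2) * c powr r" if "0 \<le> y" for y r
          using that c by (simp add: powr_mult powr_half_sqrt[symmetric] powr_powr)
        have x: "1 \<le> x"
        proof -
          have "1 * 1 \<le> C * real k" using C False by (intro mult_mono) auto
          then show ?thesis by (simp add: x_def)
        qed
        have c2: "c powr (m - 2) * c\<^sup>2 = c powr m" using c by (simp add: powr_diff)
        have q1: "1 \<le> x powr (p - 1)" using x p by (simp add: ge_one_powr_ge_zero)
        have R1: "R powr m = x powr p * c powr m"
          using sq[of x m] x by (simp add: R_def x_def p_def)
        have "R powr (m - 2) = x powr (p - 1) * c powr (m - 2)"
          using sq[of x "m - 2"] x by (simp add: R_def x_def p_def diff_divide_distrib)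
        then have R2: "R powr (m - 2) * c\<^sup>2 = x powr (p - 1) * c powr m"
          by (simp add: c2[symmetric])
        have "R powr m + C * (2 * R powr (m - 2) * c\<^sup>2 + c powr m)
            = R powr m + C * (2 * (R powr (m - 2) * c\<^sup>2) + c powr m)" by simp
        also have "\<dots> = (x powr p + C * (2 * x powr (p - 1) + 1)) * c powr m"
          unfolding R1 R2 by (simp add: algebra_simps)
        also have "\<dots> \<le> (x powr p + 3 * C * x powr (p - 1)) * c powr m"
          using q1 C by (intro mult_right_mono add_left_mono) (auto simp: algebra_simps)
        also have "x powr p + 3 * C * x powr (p - 1) = (x + 3 * C) * x powr (p - 1)"
          using x by (simp add: powr_diff field_simps)
        also have "\<dots> \<le> (x + 3 * C) * (x + 3 * C) powr (p - 1)"
          using x p C by (intro mult_left_mono powr_mono2) auto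
        also have "\<dots> = (x + 3 * C) powr p"
          using x C by (simp add: powr_diff)
        also have "(x + 3 * C) powr p * c powr m = (sqrt (x + 3 * C) * c) powr m"
          using x C by (simp add: sq p_def)
        also have "x + 3 * C = 3 * C * real (Suc k)" by (simp add: x_def algebra_simps)
        finally show ?thesis by (simp add: mult_right_mono)
      qed
      finally show ?thesis by simp
    qed
  qed simp
  then show ?thesis by simp
qed

text \<open>One constant has to serve all lengths and all bounds, since the
inequality is applied on every dyadic level.
The degenerate value \<open>c = 0\<close> follows by letting the bound tend to zero from above.\<close>

lemma (in prob_space) martingale_moment:
  fixes m :: real
  assumes m: "2 \<le> m"
  obtains K where "0 < K" and
    "\<And>N (G :: nat \<Rightarrow> 'a measure) Y c.
       (\<And>i. i < N \<Longrightarrow> subalgebra M (G i)) \<Longrightarrow>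
       (\<And>i j. j < i \<Longrightarrow> i < N \<Longrightarrow> Y j \<in> borel_measurable (G i)) \<Longrightarrow>
       (\<And>i. i < N \<Longrightarrow> Y i \<in> borel_measurable M) \<Longrightarrow>
       (\<And>i. i < N \<Longrightarrow> AE \<omega> in M. real_cond_exp M (G i) (Y i) \<omega> = 0) \<Longrightarrow>
       (\<And>i. i < N \<Longrightarrow> integrable M (\<lambda>\<omega>. \<bar>Y i \<omega>\<bar> powr m)) \<Longrightarrow>
       0 \<le> c \<Longrightarrow> (\<And>i. i < N \<Longrightarrow> (\<integral>\<omega>. \<bar>Y i \<omega>\<bar> powr m \<partial>M) \<le> c powr m) \<Longrightarrow>
       (\<integral>\<omega>. \<bar>\<Sum>i<N. Y i \<omega>\<bar> powr m \<partial>M) \<le> (K * sqrt (real N) * c) powr m"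
proof -
  from powr_second_order[OF m] obtain C where C: "1 \<le> C" and
    taylor: "\<And>a b. \<bar>a + b\<bar> powr m
       \<le> \<bar>a\<bar> powr m + m * (sgn a * \<bar>a\<bar> powr (m - 1)) * b + C * (\<bar>a\<bar> powr (m - 2) * b\<^sup>2 + \<bar>b\<bar> powr m)"
    by blast
  show thesis
  proof (rule that[of "sqrt (3 * C)"])
    show "0 < sqrt (3 * C)" using C by simp
    fix N c and G :: "nat \<Rightarrow> 'a measure" and Y :: "nat \<Rightarrow> 'a \<Rightarrow> real"
    assume h: "\<And>i. i < N \<Longrightarrow> subalgebra M (G i)"
      "\<And>i j. j < i \<Longrightarrow> i < N \<Longrightarrow> Y j \<in> borel_measurable (G i)"
      "\<And>i. i < N \<Longrightarrow> Y i \<in> borel_measurable M"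
      "\<And>i. i < N \<Longrightarrow> AE \<omega> in M. real_cond_exp M (G i) (Y i) \<omega> = 0"
      "\<And>i. i < N \<Longrightarrow> integrable M (\<lambda>\<omega>. \<bar>Y i \<omega>\<bar> powr m)"
      and c: "0 \<le> c" and hc: "\<And>i. i < N \<Longrightarrow> (\<integral>\<omega>. \<bar>Y i \<omega>\<bar> powr m \<partial>M) \<le> c powr m"
    have "\<forall>\<^sub>F d in at_right c. (\<integral>\<omega>. \<bar>\<Sum>i<N. Y i \<omega>\<bar> powr m \<partial>M) \<le> (sqrt (3 * C) * sqrt (real N) * d) powr m"
    proof (rule eventually_mono)
      show "\<forall>\<^sub>F d in at_right c. d > c" by (simp add: eventually_at_right_less)
      fix d assume d: "d > c"
      have cd: "c powr m \<le> d powr m" using c d m by (intro powr_mono2) auto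
      have "(\<integral>\<omega>. \<bar>\<Sum>i<N. Y i \<omega>\<bar> powr m \<partial>M) \<le> (sqrt (3 * C * real N) * d) powr m"
        by (rule martingale_moment_pos[OF m C taylor, where G = G])
          (use h c d in \<open>auto intro: order_trans[OF hc cd]\<close>)
      then show "(\<integral>\<omega>. \<bar>\<Sum>i<N. Y i \<omega>\<bar> powr m \<partial>M) \<le> (sqrt (3 * C) * sqrt (real N) * d) powr m"
        by (simp add: real_sqrt_mult)
    qed
    moreover have "((\<lambda>d. (sqrt (3 * C) * sqrt (real N) * d) powr m) \<longlongrightarrow> (sqrt (3 * C) * sqrt (real N) * c) powr m) (at_right c)"
    proof (rule tendsto_powr'[OF _ tendsto_const])
      show "((\<lambda>d. sqrt (3 * C) * sqrt (real N) * d) \<longlongrightarrow> sqrt (3 * C) * sqrt (real N) * c) (at_right c)"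
        by (intro tendsto_intros)
      have "\<forall>\<^sub>F d in at_right c. 0 \<le> sqrt (3 * C) * sqrt (real N) * d"
        by (rule eventually_mono[OF eventually_at_right_less[of c]]) (use C c in auto)
      then show "sqrt (3 * C) * sqrt (real N) * c \<noteq> 0 \<or>
          0 < m \<and> (\<forall>\<^sub>F d in at_right c. 0 \<le> sqrt (3 * C) * sqrt (real N) * d)"
        using m by simp
    qed
    ultimately show "(\<integral>\<omega>. \<bar>\<Sum>i<N. Y i \<omega>\<bar> powr m \<partial>M) \<le> (sqrt (3 * C) * sqrt (real N) * c) powr m"
      by (intro tendsto_lowerbound) auto
  qed
qed

section \<open>The drift on one dyadic level\<close>

text \<open>Any sequence that is superpolynomial and subexponential would serve.\<close>

definition subexp_weight :: "nat \<Rightarrow> real" where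
  "subexp_weight n = 2 powr sqrt (real n)"

lemma subexp_weight_ge_1: "1 \<le> subexp_weight n"
  by (simp add: subexp_weight_def ge_one_powr_ge_zero)

lemma summable_subexp_weight_powr:
  assumes "0 < c"
  shows "summable (\<lambda>n. subexp_weight n powr (- c))"
proof (rule summable_comparison_test_bigo)
  show "summable (\<lambda>n. norm (1 / real n ^ 2))"
    using inverse_power_summable[of 2, where 'a = real] by (simp add: inverse_eq_divide)
  show "(\<lambda>n. subexp_weight n powr (- c)) \<in> O(\<lambda>n. 1 / real n ^ 2)"
    unfolding subexp_weight_def using assms by real_asymp
qed

lemma summable_subexp_weight_geometric:
  assumes "0 < e"
  shows "summable (\<lambda>n. subexp_weight n * 2 powr (- e * real n))"
proof (rule summable_comparison_test_bigo)
  show "summable (\<lambda>n. norm (1 / real n ^ 2))"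
    using inverse_power_summable[of 2, where 'a = real] by (simp add: inverse_eq_divide)
  show "(\<lambda>n. subexp_weight n * 2 powr (- e * real n)) \<in> O(\<lambda>n. 1 / real n ^ 2)"
    unfolding subexp_weight_def using assms by real_asymp
qed

text \<open>Compare every \<open>x\<^sub>i\<close> with \<open>\<mu> = L / N\<close>, a bound on their mean: below it \<open>x\<^sub>i\<^sup>b\<close> is at most \<open>\<mu>\<^sup>b\<close>, and above it at
most \<open>\<mu>\<^bsup>b-1\<^esup> x\<^sub>i\<close>. Adding both bounds loses a factor 2 against Jensen's inequality.\<close>

lemma sum_powr_concave_le:
  fixes x :: "nat \<Rightarrow> real"
  assumes b: "0 \<le> b" "b \<le> 1" and N: "0 < N" and x: "\<And>i. i < N \<Longrightarrow> 0 \<le> x i" and sum: "(\<Sum>i<N. x i) \<le> L"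
  shows "(\<Sum>i<N. npow (x i) b) \<le> 2 * real N powr (1 - b) * npow L b"
proof -
  have L: "0 \<le> L" using order_trans[OF sum_nonneg sum] x by auto
  consider "b = 0" | "b > 0" "L = 0" | "b > 0" "L > 0" using b L by linarith
  then show ?thesis
  proof cases
    case 1
    then show ?thesis using N by (simp add: npow_def)
  next
    case 2
    then have "x i = 0" if "i < N" for i
      using sum_nonneg_eq_0_iff[of "{..<N}" x] sum x that sum_nonneg[of "{..<N}" x] by force
    then show ?thesis using 2 by (simp add: npow_def)
  next
    case 3
    define \<mu> where "\<mu> = L / real N"
    have mu: "0 < \<mu>" using 3 N by (simp add: \<mu>_def)
    have "npow (x i) b \<le> \<mu> powr b + \<mu> powr (b - 1) * x i" if "i < N" for i
    proof (cases "x i \<le> \<mu>")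
      case True
      then have "x i powr b \<le> \<mu> powr b" using b x[OF that] by (intro powr_mono2) auto
      then show ?thesis using 3 x[OF that] by (simp add: npow_def add_increasing2)
    next
      case False
      then have "x i powr b = x i powr (b - 1) * x i" using mu by (simp add: powr_diff)
      also have "\<dots> \<le> \<mu> powr (b - 1) * x i"
        using False mu b by (intro mult_right_mono powr_mono2') auto
      finally show ?thesis using 3 by (simp add: npow_def add_increasing)
    qed
    then have "(\<Sum>i<N. npow (x i) b) \<le> (\<Sum>i<N. \<mu> powr b + \<mu> powr (b - 1) * x i)"
      by (intro sum_mono) auto
    also have "\<dots> = real N * \<mu> powr b + \<mu> powr (b - 1) * (\<Sum>i<N. x i)"
      by (simp add: sum.distrib sum_distrib_left)
    also have "\<dots> \<le> real N * \<mu> powr b + \<mu> powr (b - 1) * L"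
      using sum by (intro add_left_mono mult_left_mono) auto
    also have "\<dots> = 2 * real N powr (1 - b) * npow L b"
      using N 3 by (simp add: \<mu>_def npow_def powr_divide powr_diff field_simps)
    finally show ?thesis .
  qed
qed

text \<open>The terms are split at \<open>x\<^sub>i = L / w\<close>. At most \<open>w\<close> indices lie above, and there \<open>D\<close> bounds \<open>K\<^sub>i\<close>; counting
is replaced by the inequality \<open>1 \<le> w x\<^sub>i / L\<close>. Below, \<open>x\<^sub>i\<^sup>b \<le> x\<^sub>i (L / w)\<^bsup>b-1\<^esup>\<close>, which sums to
\<open>w\<^bsup>-(b-1)\<^esup> L\<^sup>b\<close>.\<close>

lemma sum_dominated_by_superlinear:
  fixes x K :: "nat \<Rightarrow> real"
  assumes b: "1 < b" and w: "0 < w" and G: "0 \<le> G" and D: "0 \<le> D"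
    and x: "\<And>i. i < N \<Longrightarrow> 0 \<le> x i" and sum: "(\<Sum>i<N. x i) \<le> L"
    and KG: "\<And>i. i < N \<Longrightarrow> K i \<le> G * x i powr b" and KD: "\<And>i. i < N \<Longrightarrow> K i \<le> D"
  shows "(\<Sum>i<N. K i) \<le> w powr (- (b - 1)) * (G * L powr b) + w * D"
proof -
  have L: "0 \<le> L" using order_trans[OF sum_nonneg sum] x by auto
  show ?thesis
  proof (cases "L = 0")
    case True
    then have "x i = 0" if "i < N" for i
      using sum_nonneg_eq_0_iff[of "{..<N}" x] sum x that sum_nonneg[of "{..<N}" x] by force
    then have "(\<Sum>i<N. K i) \<le> 0" using KG by (intro sum_nonpos) force
    then show ?thesis using w D True by (simp add: order_trans[OF _ mult_nonneg_nonneg])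
  next
    case False
    then have L: "0 < L" using L by simp
    have "K i \<le> D * (w * x i / L) + G * (x i * (L / w) powr (b - 1))" if i: "i < N" for i
    proof (cases "L / w \<le> x i")
      case True
      then have "1 \<le> w * x i / L" using w L by (simp add: field_simps)
      then have "D * 1 \<le> D * (w * x i / L)" using D by (intro mult_left_mono)
      then show ?thesis using KD[OF i] G x[OF i] by (simp add: add_increasing2)
    next
      case False
      have "x i powr b = x i * x i powr (b - 1)" using x[OF i] by (cases "x i = 0") (auto simp: powr_diff)
      also have "\<dots> \<le> x i * (L / w) powr (b - 1)"
        using False x[OF i] b by (intro mult_left_mono powr_mono2) auto
      finally have "G * x i powr b \<le> G * (x i * (L / w) powr (b - 1))"
        using G by (rule mult_left_mono)
      then show ?thesis using KG[OF i] D x[OF i] w L by (simp add: add_increasing)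
    qed
    then have "(\<Sum>i<N. K i) \<le> (\<Sum>i<N. D * (w * x i / L) + G * (x i * (L / w) powr (b - 1)))"
      by (intro sum_mono) auto
    also have "\<dots> = (D * w / L + G * (L / w) powr (b - 1)) * (\<Sum>i<N. x i)"
      unfolding sum_distrib_left by (intro sum.cong) (simp_all add: algebra_simps)
    also have "\<dots> \<le> (D * w / L + G * (L / w) powr (b - 1)) * L"
      using D w L G by (intro mult_left_mono[OF sum]) auto
    also have "\<dots> = w powr (- (b - 1)) * (G * L powr b) + w * D"
    proof -
      have "(L / w) powr (b - 1) * L = w powr (- (b - 1)) * L powr b"
        using L w by (simp add: powr_divide powr_minus powr_diff field_simps)
      then show ?thesis using L by (simp add: algebra_simps)
    qed
    finally show ?thesis .
  qed
qed

lemma npow_nonneg: "0 \<le> npow x a" by (simp add: npow_def)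

lemma npow_mono: "0 \<le> a \<Longrightarrow> 0 \<le> x \<Longrightarrow> x \<le> y \<Longrightarrow> npow x a \<le> npow y a"
  by (simp add: npow_def powr_mono2)

lemma npow_div_pow2:
  assumes "0 \<le> x" "0 \<le> a"
  shows "npow (x / 2 ^ n) a = 2 powr (- a * real n) * npow x a"
  using assms by (simp add: npow_def powr_divide powr_minus powr_powr powr_realpow[symmetric] mult.commute field_simps)

text \<open>In the application \<open>K\<^sub>i\<close> is the absolute drift on the \<open>i\<close>-th cell, \<open>x\<^sub>i\<close> the control of that cell, \<open>L\<close> the
control of the whole interval and \<open>D\<close> a bound on the drifts of the level. The sequence \<open>a\<close> depends on
the exponents only, and its summability makes the control terms of all levels add up to
a multiple of one.\<close>

lemma drift_level_bound:
  fixes \<alpha> \<beta> :: real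
  assumes ab: "0 \<le> \<alpha>" "0 \<le> \<beta>" "1 < \<alpha> + \<beta>"
  obtains a where "summable a" and "\<And>n. 0 \<le> a n" and
    "\<And>n (x :: nat \<Rightarrow> real) (K :: nat \<Rightarrow> real) L h G D. 0 \<le> h \<Longrightarrow> 0 \<le> G \<Longrightarrow> 0 \<le> D \<Longrightarrow>
       (\<And>i. i < 2^n \<Longrightarrow> 0 \<le> x i) \<Longrightarrow> (\<Sum>i<2^n. x i) \<le> L \<Longrightarrow>
       (\<And>i. i < 2^n \<Longrightarrow> K i \<le> G * npow (h / 2 ^ n) \<alpha> * npow (x i) \<beta>) \<Longrightarrow>
       (\<And>i. i < 2^n \<Longrightarrow> K i \<le> D) \<Longrightarrow>
       (\<Sum>i<2^n. K i) \<le> a n * (G * npow h \<alpha> * npow L \<beta>) + subexp_weight n * D"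
proof (cases "\<beta> \<le> 1")
  case True
  define a :: "nat \<Rightarrow> real" where "a n = 2 * (2 powr - (\<alpha> + \<beta> - 1)) ^ n" for n
  have "2 powr - (\<alpha> + \<beta> - 1) < (2::real) powr 0" using ab by (intro powr_less_mono) auto
  then have sa: "summable a" unfolding a_def by (intro summable_mult summable_geometric) auto
  have bound: "(\<Sum>i<2^n. K i) \<le> a n * (G * npow h \<alpha> * npow L \<beta>) + subexp_weight n * D"
    if h: "0 \<le> h" and G: "0 \<le> G" and D: "0 \<le> D" and x: "\<And>i. i < 2^n \<Longrightarrow> 0 \<le> x i" and s: "(\<Sum>i<2^n. x i) \<le> L"
      and K: "\<And>i. i < 2^n \<Longrightarrow> K i \<le> G * npow (h / 2 ^ n) \<alpha> * npow (x i) \<beta>"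
      and KD: "\<And>i. i < 2^n \<Longrightarrow> K i \<le> D"
    for n h G D L and x K :: "nat \<Rightarrow> real"
  proof -
    have "(\<Sum>i<2^n. K i) \<le> G * npow (h / 2 ^ n) \<alpha> * (\<Sum>i<2^n. npow (x i) \<beta>)"
      unfolding sum_distrib_left using K by (intro sum_mono) auto
    also have "\<dots> \<le> G * npow (h / 2 ^ n) \<alpha> * (2 * real (2 ^ n) powr (1 - \<beta>) * npow L \<beta>)"
      using sum_powr_concave_le[of \<beta> "2 ^ n" x L] ab True x s G
      by (intro mult_left_mono) (auto simp: npow_nonneg)
    also have "\<dots> = a n * (G * npow h \<alpha> * npow L \<beta>)"
    proof -
      have "(2 powr - (\<alpha> + \<beta> - 1)) ^ n = 2 powr (- \<alpha> * real n) * (2::real) powr (real n * (1 - \<beta>))"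
        by (simp only: powr_power powr_add[symmetric]) (simp add: algebra_simps)
      moreover have "real (2 ^ n) powr (1 - \<beta>) = 2 powr (real n * (1 - \<beta>))"
        by (simp add: powr_powr powr_realpow[symmetric])
      ultimately show ?thesis using h ab by (simp add: npow_div_pow2 a_def)
    qed
    finally show ?thesis using D subexp_weight_ge_1[of n] by (simp add: add_increasing2)
  qed
  have a0: "0 \<le> a n" for n by (simp add: a_def)
  show thesis
    by (rule that[of a]) (rule sa, rule a0, rule bound)
next
  case False
  define a :: "nat \<Rightarrow> real" where "a n = subexp_weight n powr (- (\<beta> - 1))" for n
  have sa: "summable a" unfolding a_def using False by (intro summable_subexp_weight_powr) auto
  have bound: "(\<Sum>i<2^n. K i) \<le> a n * (G * npow h \<alpha> * npow L \<beta>) + subexp_weight n * D"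
    if h: "0 \<le> h" and G: "0 \<le> G" and D: "0 \<le> D" and x: "\<And>i. i < 2^n \<Longrightarrow> 0 \<le> x i" and s: "(\<Sum>i<2^n. x i) \<le> L"
      and K: "\<And>i. i < 2^n \<Longrightarrow> K i \<le> G * npow (h / 2 ^ n) \<alpha> * npow (x i) \<beta>"
      and KD: "\<And>i. i < 2^n \<Longrightarrow> K i \<le> D"
    for n h G D L and x K :: "nat \<Rightarrow> real"
  proof -
    have np: "npow y \<beta> = y powr \<beta>" for y using False by (simp add: npow_def)
    have "(\<Sum>i<2^n. K i) \<le> a n * ((G * npow h \<alpha>) * L powr \<beta>) + subexp_weight n * D"
      unfolding a_def
    proof (rule sum_dominated_by_superlinear[OF _ _ _ D _ s])
      fix i :: nat assume i: "i < 2 ^ n"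
      have "npow (h / 2 ^ n) \<alpha> \<le> npow h \<alpha>"
        using h ab by (intro npow_mono) (auto simp: divide_le_eq_1 intro: order_trans[OF divide_left_mono[of 1 "2 ^ n" h]])
      then have "G * npow (h / 2 ^ n) \<alpha> * npow (x i) \<beta> \<le> G * npow h \<alpha> * npow (x i) \<beta>"
        using G by (intro mult_right_mono mult_left_mono) (auto simp: npow_nonneg)
      then show "K i \<le> G * npow h \<alpha> * x i powr \<beta>" using K[OF i] np by simp
    qed (use False G x KD subexp_weight_ge_1[of n] in \<open>auto simp: npow_nonneg\<close>)
    then show ?thesis by (simp add: np)
  qed
  have a0: "0 \<le> a n" for n by (simp add: a_def)
  show thesis
    by (rule that[of a]) (rule sa, rule a0, rule bound)
qed

section \<open>Dyadic refinement\<close>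

lemma Lm_norm_le_iff:
  assumes "0 < m" "0 \<le> R"
  shows "Lm_norm M m f \<le> R \<longleftrightarrow> (\<integral>\<omega>. \<bar>f \<omega>\<bar> powr m \<partial>M) \<le> R powr m"
proof -
  define I where "I = (\<integral>\<omega>. \<bar>f \<omega>\<bar> powr m \<partial>M)"
  have I: "0 \<le> I" by (simp add: I_def)
  have 1: "I powr (1 / m) \<le> R" if "I \<le> R powr m"
    using powr_mono2[of "1 / m" I "R powr m"] that I assms by (simp add: powr_powr)
  have 2: "I \<le> R powr m" if "I powr (1 / m) \<le> R"
    using powr_mono2[of m "I powr (1 / m)" R] that I assms by (simp add: powr_powr)
  show ?thesis using 1 2 by (auto simp: Lm_norm_def I_def)
qed

definition dyadic :: "real \<Rightarrow> real \<Rightarrow> nat \<Rightarrow> nat \<Rightarrow> real" where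
  "dyadic s t n i = s + real i * ((t - s) / 2 ^ n)"

definition dyadic_mid :: "real \<Rightarrow> real \<Rightarrow> nat \<Rightarrow> nat \<Rightarrow> real" where
  "dyadic_mid s t n i = (dyadic s t n i + dyadic s t n (Suc i)) / 2"

definition dyadic_cell :: "(real \<Rightarrow> real \<Rightarrow> 'b) \<Rightarrow> real \<Rightarrow> real \<Rightarrow> nat \<Rightarrow> nat \<Rightarrow> 'b" where
  "dyadic_cell X s t n i = X (dyadic s t n i) (dyadic s t n (Suc i))"

lemma dyadic_0 [simp]: "dyadic s t n 0 = s"
  and dyadic_last [simp]: "dyadic s t n (2 ^ n) = t"
  by (simp_all add: dyadic_def)

lemma dyadic_Suc: "dyadic s t n (Suc i) = dyadic s t n i + (t - s) / 2 ^ n"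
  unfolding dyadic_def by (simp only: of_nat_Suc distrib_right mult_1 add_ac)

lemma dyadic_mono: "s \<le> t \<Longrightarrow> i \<le> j \<Longrightarrow> dyadic s t n i \<le> dyadic s t n j"
  by (simp add: dyadic_def mult_right_mono divide_right_mono)

lemma dyadic_bounds:
  assumes "s \<le> t" "i \<le> 2 ^ n"
  shows "s \<le> dyadic s t n i" "dyadic s t n i \<le> t"
  using dyadic_mono[OF assms(1), of 0 i n] dyadic_mono[OF assms, of n] by simp_all

lemma dyadic_mid_bounds:
  assumes "s \<le> t"
  shows "dyadic s t n i \<le> dyadic_mid s t n i" "dyadic_mid s t n i \<le> dyadic s t n (Suc i)"
  using dyadic_mono[OF assms, of i "Suc i" n] by (auto simp: dyadic_mid_def)

lemma dyadic_refine: "dyadic s t (Suc n) (2 * i) = dyadic s t n i"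
  "dyadic s t (Suc n) (Suc (2 * i)) = dyadic_mid s t n i"
  by (simp_all add: dyadic_def dyadic_mid_def field_simps)

lemma dyadic_cell_in_simplex:
  assumes "(s, t) \<in> simplex2 S T" "i < 2 ^ n"
  shows "(dyadic s t n i, dyadic s t n (Suc i)) \<in> simplex2 S T"
  using assms dyadic_bounds[of s t i n] dyadic_bounds[of s t "Suc i" n] dyadic_mono[of s t i "Suc i" n]
  by (auto simp: simplex2_def)

definition dyadic_sum :: "(real \<Rightarrow> real \<Rightarrow> 'a \<Rightarrow> real) \<Rightarrow> real \<Rightarrow> real \<Rightarrow> nat \<Rightarrow> 'a \<Rightarrow> real" where
  "dyadic_sum A s t n \<omega> = (\<Sum>i<2^n. dyadic_cell A s t n i \<omega>)"

lemma sum_lessThan_double: "(\<Sum>j<2 * k. g j) = (\<Sum>i<k. g (2 * i) + g (Suc (2 * i)))"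
  for g :: "nat \<Rightarrow> 'b::comm_monoid_add"
  by (induction k) (simp_all add: ac_simps)

lemma dyadic_sum_refine:
  "dyadic_sum A s t n \<omega> - dyadic_sum A s t (Suc n) \<omega>
     = (\<Sum>i<2^n. dyadic_cell (midpoint_increments A) s t n i \<omega>)"
proof -
  have r: "dyadic s t (Suc n) (Suc (Suc (2 * i))) = dyadic s t n (Suc i)" for i
    using dyadic_refine(1)[of s t n "Suc i"] by simp
  have "dyadic_sum A s t (Suc n) \<omega> = (\<Sum>i<2^n. A (dyadic s t n i) (dyadic_mid s t n i) \<omega>
        + A (dyadic_mid s t n i) (dyadic s t n (Suc i)) \<omega>)"
    by (simp add: dyadic_sum_def dyadic_cell_def sum_lessThan_double dyadic_refine r)
  then show ?thesis
    by (simp add: dyadic_sum_def dyadic_cell_def midpoint_increments_def increment_def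
        dyadic_mid_def sum_subtractf[symmetric] algebra_simps)
qed

lemma dyadic_sum_telescope:
  "A s t \<omega> - dyadic_sum A s t N \<omega>
     = (\<Sum>n<N. \<Sum>i<2^n. dyadic_cell (midpoint_increments A) s t n i \<omega>)"
proof (induction N)
  case 0
  then show ?case using dyadic_last[of s t 0] by (simp add: dyadic_sum_def dyadic_cell_def)
next
  case (Suc N)
  then show ?case using dyadic_sum_refine[of A s t N \<omega>] by simp
qed

section \<open>The remainder as a functional of the midpoint increments\<close>

definition drift :: "'a measure \<Rightarrow> (real \<Rightarrow> 'a measure) \<Rightarrow> (real \<Rightarrow> real \<Rightarrow> 'a \<Rightarrow> real)
    \<Rightarrow> real \<Rightarrow> real \<Rightarrow> nat \<Rightarrow> nat \<Rightarrow> 'a \<Rightarrow> real" where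
  "drift M F X s t n i = real_cond_exp M (F (dyadic_mid s t n i)) (dyadic_cell X s t n i)"

definition noise :: "'a measure \<Rightarrow> (real \<Rightarrow> 'a measure) \<Rightarrow> (real \<Rightarrow> real \<Rightarrow> 'a \<Rightarrow> real)
    \<Rightarrow> real \<Rightarrow> real \<Rightarrow> nat \<Rightarrow> 'a \<Rightarrow> real" where
  "noise M F X s t n \<omega> = (\<Sum>i<2^n. dyadic_cell X s t n i \<omega> - drift M F X s t n i \<omega>)"

text \<open>The \<open>m\<close>-norm over the cells of a level dominates the largest drift, and its \<open>m\<close>-th moment is simply the
sum of the \<open>m\<close>-th moments of the drifts.\<close>

definition drift_norm :: "'a measure \<Rightarrow> (real \<Rightarrow> 'a measure) \<Rightarrow> real \<Rightarrow> (real \<Rightarrow> real \<Rightarrow> 'a \<Rightarrow> real)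
    \<Rightarrow> real \<Rightarrow> real \<Rightarrow> nat \<Rightarrow> 'a \<Rightarrow> real" where
  "drift_norm M F m X s t n \<omega> = (\<Sum>i<2^n. \<bar>drift M F X s t n i \<omega>\<bar> powr m) powr (1 / m)"

definition level_error :: "'a measure \<Rightarrow> (real \<Rightarrow> 'a measure) \<Rightarrow> real \<Rightarrow> (real \<Rightarrow> real \<Rightarrow> 'a \<Rightarrow> real)
    \<Rightarrow> real \<Rightarrow> real \<Rightarrow> nat \<Rightarrow> 'a \<Rightarrow> real" where
  "level_error M F m X s t n \<omega> = \<bar>noise M F X s t n \<omega>\<bar> + subexp_weight n * drift_norm M F m X s t n \<omega>"

definition sewing_error :: "'a measure \<Rightarrow> (real \<Rightarrow> 'a measure) \<Rightarrow> real \<Rightarrow> (real \<Rightarrow> real \<Rightarrow> 'a \<Rightarrow> real)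
    \<Rightarrow> real \<Rightarrow> real \<Rightarrow> 'a \<Rightarrow> real" where
  "sewing_error M F m X s t \<omega> = (\<Sum>n. level_error M F m X s t n \<omega>)"

lemma abs_drift_le_norm:
  assumes "0 < m" "i < 2 ^ n"
  shows "\<bar>drift M F X s t n i \<omega>\<bar> \<le> drift_norm M F m X s t n \<omega>"
proof -
  have "\<bar>drift M F X s t n i \<omega>\<bar> = (\<bar>drift M F X s t n i \<omega>\<bar> powr m) powr (1 / m)"
    using assms by (simp add: powr_powr)
  also have "\<dots> \<le> drift_norm M F m X s t n \<omega>"
    unfolding drift_norm_def using assms by (intro powr_mono2 member_le_sum) auto
  finally show ?thesis .
qed

lemma drift_norm_nonneg: "0 \<le> drift_norm M F m X s t n \<omega>"
  by (simp add: drift_norm_def)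

lemma level_error_nonneg: "0 \<le> level_error M F m X s t n \<omega>"
  using subexp_weight_ge_1[of n] by (simp add: level_error_def drift_norm_nonneg)

locale filtered_prob_space = prob_space M for M :: "'a measure" +
  fixes F :: "real \<Rightarrow> 'a measure" and T :: real
  assumes filtration: "filtration_on M T F"
begin

lemma subalgebra_F: "0 \<le> t \<Longrightarrow> t \<le> T \<Longrightarrow> subalgebra M (F t)"
  using filtration by (auto simp: filtration_on_def)

lemma measurable_F_mono:
  assumes "f \<in> borel_measurable (F s)" "0 \<le> s" "s \<le> t" "t \<le> T"
  shows "f \<in> borel_measurable (F t)"
proof -
  have "subalgebra (F t) (F s)"
    using filtration subalgebra_F[of s] subalgebra_F[of t] assms
    by (auto simp: filtration_on_def subalgebra_def)
  then show ?thesis using assms(1) by (rule measurable_from_subalg)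
qed

lemma drift_measurable [measurable]: "drift M F X s t n i \<in> borel_measurable M"
  unfolding drift_def by simp

lemma dyadic_mid_in_range:
  assumes "(s, t) \<in> simplex2 S T" "0 \<le> S" "i < 2 ^ n"
  shows "0 \<le> dyadic_mid s t n i" "dyadic_mid s t n i \<le> T"
  using dyadic_cell_in_simplex[OF assms(1,3)] assms(1,2) dyadic_mid_bounds[of s t n i]
  by (auto simp: simplex2_def)

lemma drift_cong_AE:
  assumes st: "(s, t) \<in> simplex2 S T" and S: "0 \<le> S"
    and XY: "\<forall>(s, t)\<in>simplex2 S T. X s t \<in> Lm_space M m \<and> Y s t \<in> Lm_space M m \<and>
                (AE \<omega> in M. X s t \<omega> = Y s t \<omega>)"
    and i: "i < 2 ^ n"
  shows "AE \<omega> in M. dyadic_cell X s t n i \<omega> = dyadic_cell Y s t n i \<omega> \<and>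
           drift M F X s t n i \<omega> = drift M F Y s t n i \<omega>"
proof -
  interpret sigma_finite_subalgebra M "F (dyadic_mid s t n i)"
    by (intro sigma_finite_subalgebraI subalgebra_F dyadic_mid_in_range[OF st S i])
  have 1: "AE \<omega> in M. dyadic_cell X s t n i \<omega> = dyadic_cell Y s t n i \<omega>"
    and "dyadic_cell X s t n i \<in> borel_measurable M" "dyadic_cell Y s t n i \<in> borel_measurable M"
    using XY dyadic_cell_in_simplex[OF st i] by (auto simp: dyadic_cell_def Lm_space_def)
  then have "AE \<omega> in M. drift M F X s t n i \<omega> = drift M F Y s t n i \<omega>"
    unfolding drift_def by (intro real_cond_exp_cong)
  with 1 show ?thesis by auto
qed

text \<open>Only countably many cells and conditional expectations enter, so almost sure equality of the families
survives.\<close>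

lemma sewing_error_functional:
  assumes S: "0 \<le> S"
  shows "Lm_functional M m S T (sewing_error M F m)"
  unfolding Lm_functional_def
proof (intro allI impI ballI)
  fix X Y z assume XY: "\<forall>(s, t)\<in>simplex2 S T. X s t \<in> Lm_space M m \<and> Y s t \<in> Lm_space M m \<and>
                (AE \<omega> in M. X s t \<omega> = Y s t \<omega>)" and "z \<in> simplex2 S T"
  then obtain s t where z: "z = (s, t)" and st: "(s, t) \<in> simplex2 S T" by (cases z) auto
  have "AE \<omega> in M. \<forall>n. \<forall>i\<in>{..<2^n}. dyadic_cell X s t n i \<omega> = dyadic_cell Y s t n i \<omega> \<and>
           drift M F X s t n i \<omega> = drift M F Y s t n i \<omega>"
    unfolding AE_all_countable using drift_cong_AE[OF st S XY]
    by (intro allI AE_finite_allI) auto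
  then have "AE \<omega> in M. sewing_error M F m X s t \<omega> = sewing_error M F m Y s t \<omega>"
  proof eventually_elim
    case (elim \<omega>)
    then have "noise M F X s t n \<omega> = noise M F Y s t n \<omega>"
      "drift_norm M F m X s t n \<omega> = drift_norm M F m Y s t n \<omega>" for n
      by (auto simp: noise_def drift_norm_def)
    then show ?case by (simp add: sewing_error_def level_error_def)
  qed
  then show "case z of (s, t) \<Rightarrow> AE \<omega> in M. sewing_error M F m X s t \<omega> = sewing_error M F m Y s t \<omega>"
    by (simp add: z)
qed

section \<open>Moments of the remainder\<close>

lemma drift_moment:
  assumes m: "2 \<le> m" and S: "0 \<le> S" and st: "(s, t) \<in> simplex2 S T" and i: "i < 2 ^ n"
    and X: "\<And>s t. (s, t) \<in> simplex2 S T \<Longrightarrow> X s t \<in> Lm_space M m"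
    and q: "0 \<le> q" and Xq: "Lm_norm M m (dyadic_cell X s t n i) \<le> q"
  shows "integrable M (\<lambda>\<omega>. \<bar>drift M F X s t n i \<omega>\<bar> powr m)"
    and "(\<integral>\<omega>. \<bar>drift M F X s t n i \<omega>\<bar> powr m \<partial>M) \<le> q powr m"
    and "integrable M (\<lambda>\<omega>. \<bar>dyadic_cell X s t n i \<omega> - drift M F X s t n i \<omega>\<bar> powr m)"
    and "(\<integral>\<omega>. \<bar>dyadic_cell X s t n i \<omega> - drift M F X s t n i \<omega>\<bar> powr m \<partial>M) \<le> (2 * q) powr m"
proof -
  have sub: "subalgebra M (F (dyadic_mid s t n i))"
    by (intro subalgebra_F dyadic_mid_in_range[OF st S i])
  have [measurable]: "dyadic_cell X s t n i \<in> borel_measurable M"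
    and Xi: "integrable M (\<lambda>\<omega>. \<bar>dyadic_cell X s t n i \<omega>\<bar> powr m)"
    using X[OF dyadic_cell_in_simplex[OF st i]] by (auto simp: Lm_space_def dyadic_cell_def)
  have Xm: "(\<integral>\<omega>. \<bar>dyadic_cell X s t n i \<omega>\<bar> powr m \<partial>M) \<le> q powr m"
    using Xq q m by (simp add: Lm_norm_le_iff)
  show d: "integrable M (\<lambda>\<omega>. \<bar>drift M F X s t n i \<omega>\<bar> powr m)"
    unfolding drift_def using m by (intro cond_exp_moment sub Xi) auto
  show dm: "(\<integral>\<omega>. \<bar>drift M F X s t n i \<omega>\<bar> powr m \<partial>M) \<le> q powr m"
    unfolding drift_def using m by (intro order_trans[OF cond_exp_moment(2) Xm] sub Xi) auto
  have minus: "integrable M (\<lambda>\<omega>. \<bar>- drift M F X s t n i \<omega>\<bar> powr m)"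
    using d by simp
  show "integrable M (\<lambda>\<omega>. \<bar>dyadic_cell X s t n i \<omega> - drift M F X s t n i \<omega>\<bar> powr m)"
    using moment_add(1)[OF _ _ _ Xi minus] m by simp
  have "(\<integral>\<omega>. \<bar>dyadic_cell X s t n i \<omega> - drift M F X s t n i \<omega>\<bar> powr m \<partial>M)
      \<le> 2 powr (m - 1) * ((\<integral>\<omega>. \<bar>dyadic_cell X s t n i \<omega>\<bar> powr m \<partial>M)
          + (\<integral>\<omega>. \<bar>drift M F X s t n i \<omega>\<bar> powr m \<partial>M))"
    using moment_add(2)[OF _ _ _ Xi minus] m by simp
  also have "\<dots> \<le> 2 powr (m - 1) * (q powr m + q powr m)"
    by (intro mult_left_mono add_mono Xm dm) simp
  also have "\<dots> = (2 * q) powr m"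
    using q by (simp add: powr_mult powr_diff)
  finally show "(\<integral>\<omega>. \<bar>dyadic_cell X s t n i \<omega> - drift M F X s t n i \<omega>\<bar> powr m \<partial>M) \<le> (2 * q) powr m" .
qed

text \<open>Conditioning at the midpoints, rather than at the left endpoints, still gives a filtration to which the
earlier terms are adapted: the cell \<open>j < i\<close> ends before the midpoint of the cell \<open>i\<close>.\<close>

lemma noise_terms_martingale_differences:
  assumes m: "2 \<le> m" and S: "0 \<le> S" and st: "(s, t) \<in> simplex2 S T" and i: "i < 2 ^ n"
    and X: "\<And>s t. (s, t) \<in> simplex2 S T \<Longrightarrow> X s t \<in> Lm_space M m \<and> X s t \<in> borel_measurable (F t)"
  shows "AE \<omega> in M. real_cond_exp M (F (dyadic_mid s t n i))
           (\<lambda>\<omega>. dyadic_cell X s t n i \<omega> - drift M F X s t n i \<omega>) \<omega> = 0"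
    and "j < i \<Longrightarrow> (\<lambda>\<omega>. dyadic_cell X s t n j \<omega> - drift M F X s t n j \<omega>)
           \<in> borel_measurable (F (dyadic_mid s t n i))"
proof -
  interpret sigma_finite_subalgebra M "F (dyadic_mid s t n i)"
    by (intro sigma_finite_subalgebraI subalgebra_F dyadic_mid_in_range[OF st S i])
  have Xi: "integrable M (dyadic_cell X s t n i)"
    using X[OF dyadic_cell_in_simplex[OF st i]] m
    by (auto simp: Lm_space_def dyadic_cell_def intro: integrable_if_moment[of m])
  have d: "integrable M (drift M F X s t n i)"
    unfolding drift_def by (rule real_cond_exp_int(1)[OF Xi])
  have "AE \<omega> in M. real_cond_exp M (F (dyadic_mid s t n i)) (drift M F X s t n i) \<omega> = drift M F X s t n i \<omega>"
    by (rule real_cond_exp_F_meas[OF d]) (simp add: drift_def)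
  with real_cond_exp_diff[OF Xi d]
  show "AE \<omega> in M. real_cond_exp M (F (dyadic_mid s t n i))
           (\<lambda>\<omega>. dyadic_cell X s t n i \<omega> - drift M F X s t n i \<omega>) \<omega> = 0"
    by eventually_elim (simp add: drift_def)
  assume ji: "j < i"
  then have j: "j < 2 ^ n" using i by simp
  have le: "s \<le> t" using st by (simp add: simplex2_def)
  have b: "dyadic s t n (Suc j) \<le> dyadic_mid s t n i" "dyadic_mid s t n j \<le> dyadic_mid s t n i"
    using dyadic_mono[OF le, of "Suc j" i n] dyadic_mid_bounds[OF le, of n j] dyadic_mid_bounds[OF le, of n i] ji
    by linarith+
  have "dyadic_cell X s t n j \<in> borel_measurable (F (dyadic s t n (Suc j)))"
    using X[OF dyadic_cell_in_simplex[OF st j]] by (simp add: dyadic_cell_def)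
  then have 1: "dyadic_cell X s t n j \<in> borel_measurable (F (dyadic_mid s t n i))"
    using b dyadic_mid_in_range[OF st S i] dyadic_cell_in_simplex[OF st j] S
    by (elim measurable_F_mono) (auto simp: simplex2_def)
  have "drift M F X s t n j \<in> borel_measurable (F (dyadic_mid s t n j))" by (simp add: drift_def)
  then have 2: "drift M F X s t n j \<in> borel_measurable (F (dyadic_mid s t n i))"
    using b dyadic_mid_in_range[OF st S i] dyadic_mid_in_range[OF st S j]
    by (elim measurable_F_mono) auto
  from 1 2 show "(\<lambda>\<omega>. dyadic_cell X s t n j \<omega> - drift M F X s t n j \<omega>)
           \<in> borel_measurable (F (dyadic_mid s t n i))" by simp
qed

definition small_adapted :: "real \<Rightarrow> real \<Rightarrow> real \<Rightarrow> real \<Rightarrow> (real \<Rightarrow> real \<Rightarrow> 'a \<Rightarrow> real) \<Rightarrow> bool" where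
  "small_adapted m S \<Gamma> \<epsilon> X \<longleftrightarrow>
     (\<forall>(s, t)\<in>simplex2 S T. X s t \<in> Lm_space M m \<and> X s t \<in> borel_measurable (F t) \<and>
        Lm_norm M m (X s t) \<le> \<Gamma> * \<bar>t - s\<bar> powr (1 / 2 + \<epsilon>))"

text \<open>A cell of level \<open>n\<close> has \<open>L\<^sub>m\<close> norm at most \<open>q = 2\<^bsup>-n/2\<^esup> Q\<close>, where \<open>Q\<close> contains the factor \<open>2\<^bsup>-n\<epsilon>\<^esup>\<close>. The
martingale bound costs \<open>2\<^bsup>n/2\<^esup>\<close> for the noise, and summing \<open>m\<close>-th moments costs \<open>2\<^bsup>n/m\<^esup> \<le> 2\<^bsup>n/2\<^esup>\<close> for the
drifts; both leave a multiple of \<open>Q\<close>.\<close>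

lemma level_error_moment:
  assumes m: "2 \<le> m" and S: "0 \<le> S"
  obtains K where "0 < K" and
    "\<And>X \<Gamma> \<epsilon> s t n. 0 \<le> \<Gamma> \<Longrightarrow> 0 < \<epsilon> \<Longrightarrow> small_adapted m S \<Gamma> \<epsilon> X \<Longrightarrow> (s, t) \<in> simplex2 S T \<Longrightarrow>
       level_error M F m X s t n \<in> Lm_space M m \<and>
       (\<integral>\<omega>. \<bar>level_error M F m X s t n \<omega>\<bar> powr m \<partial>M)
         \<le> (K * (subexp_weight n * 2 powr (- \<epsilon> * real n)) * (\<Gamma> * \<bar>t - s\<bar> powr (1 / 2 + \<epsilon>))) powr m"
proof (rule martingale_moment[OF m])
  fix K0 :: real
  assume K0: "0 < K0" and mart: "\<And>N (G :: nat \<Rightarrow> 'a measure) Y c.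
       (\<And>i. i < N \<Longrightarrow> subalgebra M (G i)) \<Longrightarrow>
       (\<And>i j. j < i \<Longrightarrow> i < N \<Longrightarrow> Y j \<in> borel_measurable (G i)) \<Longrightarrow>
       (\<And>i. i < N \<Longrightarrow> Y i \<in> borel_measurable M) \<Longrightarrow>
       (\<And>i. i < N \<Longrightarrow> AE \<omega> in M. real_cond_exp M (G i) (Y i) \<omega> = 0) \<Longrightarrow>
       (\<And>i. i < N \<Longrightarrow> integrable M (\<lambda>\<omega>. \<bar>Y i \<omega>\<bar> powr m)) \<Longrightarrow>
       0 \<le> c \<Longrightarrow> (\<And>i. i < N \<Longrightarrow> (\<integral>\<omega>. \<bar>Y i \<omega>\<bar> powr m \<partial>M) \<le> c powr m) \<Longrightarrow>
       (\<integral>\<omega>. \<bar>\<Sum>i<N. Y i \<omega>\<bar> powr m \<partial>M) \<le> (K0 * sqrt (real N) * c) powr m"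
  have main: "level_error M F m X s t n \<in> Lm_space M m \<and>
    (\<integral>\<omega>. \<bar>level_error M F m X s t n \<omega>\<bar> powr m \<partial>M)
      \<le> (2 * (2 * K0 + 1) * (subexp_weight n * 2 powr (- \<epsilon> * real n)) * (\<Gamma> * \<bar>t - s\<bar> powr (1 / 2 + \<epsilon>))) powr m"
    if G: "0 \<le> \<Gamma>" and e: "0 < \<epsilon>" and X: "small_adapted m S \<Gamma> \<epsilon> X" and st: "(s, t) \<in> simplex2 S T" for X \<Gamma> \<epsilon> s t n
  proof -
    define q where "q = \<Gamma> * \<bar>(t - s) / 2 ^ n\<bar> powr (1 / 2 + \<epsilon>)"
    define Q where "Q = 2 powr (- \<epsilon> * real n) * (\<Gamma> * \<bar>t - s\<bar> powr (1 / 2 + \<epsilon>))"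
    have q: "0 \<le> q" and Q: "0 \<le> Q" using G by (simp_all add: q_def Q_def)
    have h: "2 powr (real n / 2) * q = Q"
    proof -
      have "\<bar>(t - s) / 2 ^ n\<bar> powr (1 / 2 + \<epsilon>) = \<bar>t - s\<bar> powr (1 / 2 + \<epsilon>) / 2 powr (real n * (1 / 2 + \<epsilon>))"
        by (simp add: abs_divide powr_divide powr_powr powr_realpow[symmetric])
      also have "2 powr (real n * (1 / 2 + \<epsilon>)) = 2 powr (real n / 2) * 2 powr (\<epsilon> * real n)"
        by (simp only: powr_add[symmetric]) (simp add: algebra_simps)
      finally show ?thesis by (simp add: q_def Q_def powr_minus field_simps)
    qed
    have X': "\<And>s t. (s, t) \<in> simplex2 S T \<Longrightarrow> X s t \<in> Lm_space M m \<and> X s t \<in> borel_measurable (F t)"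
      using X by (auto simp: small_adapted_def)
    have Xq: "Lm_norm M m (dyadic_cell X s t n i) \<le> q" if "i < 2 ^ n" for i
      using X dyadic_cell_in_simplex[OF st that] by (force simp: small_adapted_def q_def dyadic_cell_def dyadic_Suc)
    note dm = drift_moment[OF m S st _ conjunct1[OF X'] q Xq]
    have Xmeas: "dyadic_cell X s t n i \<in> borel_measurable M" if "i < 2 ^ n" for i
      using X'[OF dyadic_cell_in_simplex[OF st that]] by (auto simp: Lm_space_def dyadic_cell_def)
    have [measurable]: "noise M F X s t n \<in> borel_measurable M"
      unfolding noise_def using Xmeas by (intro borel_measurable_sum borel_measurable_diff) auto
    have [measurable]: "drift_norm M F m X s t n \<in> borel_measurable M"
      unfolding drift_norm_def by measurable
    have Jint: "integrable M (\<lambda>\<omega>. \<bar>noise M F X s t n \<omega>\<bar> powr m)"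
      unfolding noise_def using m Xmeas dm(3) by (intro integrable_moment_sum) auto
    have "(\<integral>\<omega>. \<bar>noise M F X s t n \<omega>\<bar> powr m \<partial>M) \<le> (K0 * sqrt (real (2 ^ n)) * (2 * q)) powr m"
      unfolding noise_def
      using noise_terms_martingale_differences[OF m S st _ X'] dyadic_mid_in_range[OF st S] dm Xmeas q
      by (intro mart[of "2 ^ n" "\<lambda>i. F (dyadic_mid s t n i)"]) (auto intro: subalgebra_F)
    also have "K0 * sqrt (real (2 ^ n)) * (2 * q) = 2 * K0 * Q"
    proof -
      have "sqrt (real (2 ^ n)) = 2 powr (real n / 2)"
        by (simp add: powr_half_sqrt[symmetric] powr_powr powr_realpow[symmetric])
      then show ?thesis by (simp add: h[symmetric])
    qed
    finally have J: "(\<integral>\<omega>. \<bar>noise M F X s t n \<omega>\<bar> powr m \<partial>M) \<le> (2 * K0 * Q) powr m" .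
    have Dm: "\<bar>drift_norm M F m X s t n \<omega>\<bar> powr m = (\<Sum>i<2^n. \<bar>drift M F X s t n i \<omega>\<bar> powr m)" for \<omega>
      using m by (simp add: drift_norm_def powr_powr sum_nonneg)
    have Dint: "integrable M (\<lambda>\<omega>. \<bar>drift_norm M F m X s t n \<omega>\<bar> powr m)"
      unfolding Dm using dm(1) by (intro Bochner_Integration.integrable_sum) auto
    \<comment> \<open>Here \<open>m \<ge> 2\<close> enters: \<open>2\<^sup>n \<le> 2\<^bsup>nm/2\<^esup>\<close>.\<close>
    have "(\<integral>\<omega>. \<bar>drift_norm M F m X s t n \<omega>\<bar> powr m \<partial>M) = (\<Sum>i<2^n. \<integral>\<omega>. \<bar>drift M F X s t n i \<omega>\<bar> powr m \<partial>M)"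
      unfolding Dm using dm(1) by (intro Bochner_Integration.integral_sum) auto
    also have "\<dots> \<le> (\<Sum>i<(2::nat)^n. q powr m)" using dm(2) by (intro sum_mono) auto
    also have "\<dots> = 2 powr real n * q powr m" by (simp add: powr_realpow)
    also have "\<dots> \<le> 2 powr (real n / 2 * m) * q powr m"
      using mult_left_mono[OF m, of "real n / 2"] by (intro mult_right_mono powr_mono) auto
    also have "\<dots> = Q powr m"
      using q by (simp add: h[symmetric] powr_mult powr_powr)
    finally have D: "(\<integral>\<omega>. \<bar>drift_norm M F m X s t n \<omega>\<bar> powr m \<partial>M) \<le> Q powr m" .
    define w where "w = subexp_weight n"
    have w: "1 \<le> w" unfolding w_def by (rule subexp_weight_ge_1)
    have Jint': "integrable M (\<lambda>\<omega>. \<bar>\<bar>noise M F X s t n \<omega>\<bar>\<bar> powr m)" using Jint by simp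
    have wD: "\<bar>w * drift_norm M F m X s t n \<omega>\<bar> powr m = w powr m * \<bar>drift_norm M F m X s t n \<omega>\<bar> powr m" for \<omega>
      using w by (simp add: abs_mult powr_mult)
    have Dint': "integrable M (\<lambda>\<omega>. \<bar>w * drift_norm M F m X s t n \<omega>\<bar> powr m)"
      unfolding wD using Dint by simp
    have D': "(\<integral>\<omega>. \<bar>w * drift_norm M F m X s t n \<omega>\<bar> powr m \<partial>M) \<le> w powr m * Q powr m"
      unfolding wD using D by (simp add: mult_left_mono)
    \<comment> \<open>A common bound for the norms of both parts of \<open>level_error\<close>.\<close>
    define P where "P = (2 * K0 + 1) * (w * Q)"
    have P: "0 \<le> P" using K0 w Q by (simp add: P_def)
    have "2 * K0 * Q \<le> P"
    proof -
      have "2 * K0 * (1 * Q) \<le> (2 * K0 + 1) * (w * Q)"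
        using K0 w Q by (intro mult_mono mult_right_mono) auto
      then show ?thesis by (simp add: P_def)
    qed
    then have JP: "(2 * K0 * Q) powr m \<le> P powr m" using K0 Q m by (intro powr_mono2) auto
    have "1 * (w * Q) \<le> P" unfolding P_def using K0 w Q by (intro mult_right_mono) auto
    then have "(w * Q) powr m \<le> P powr m" using w Q m by (intro powr_mono2) auto
    then have DP: "w powr m * Q powr m \<le> P powr m" using w Q by (simp add: powr_mult)
    have eq: "level_error M F m X s t n = (\<lambda>\<omega>. \<bar>noise M F X s t n \<omega>\<bar> + w * drift_norm M F m X s t n \<omega>)"
      by (auto simp: level_error_def w_def)
    have 1: "integrable M (\<lambda>\<omega>. \<bar>level_error M F m X s t n \<omega>\<bar> powr m)"
      unfolding eq using m by (intro moment_add Jint' Dint') auto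
    have "(\<integral>\<omega>. \<bar>level_error M F m X s t n \<omega>\<bar> powr m \<partial>M) \<le> 2 powr (m - 1) *
        ((\<integral>\<omega>. \<bar>\<bar>noise M F X s t n \<omega>\<bar>\<bar> powr m \<partial>M) + (\<integral>\<omega>. \<bar>w * drift_norm M F m X s t n \<omega>\<bar> powr m \<partial>M))"
      unfolding eq using m by (intro moment_add Jint' Dint') auto
    also have "\<dots> \<le> 2 powr (m - 1) * (P powr m + P powr m)"
      using J D' JP DP by (intro mult_left_mono add_mono) auto
    also have "\<dots> = (2 * P) powr m" using P by (simp add: powr_mult powr_diff)
    finally have 2: "(\<integral>\<omega>. \<bar>level_error M F m X s t n \<omega>\<bar> powr m \<partial>M) \<le> (2 * P) powr m" .
    have 3: "level_error M F m X s t n \<in> borel_measurable M" unfolding eq by measurable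
    have "2 * P = 2 * (2 * K0 + 1) * (subexp_weight n * 2 powr (- \<epsilon> * real n)) * (\<Gamma> * \<bar>t - s\<bar> powr (1 / 2 + \<epsilon>))"
      by (simp add: P_def Q_def w_def)
    with 1 2 3 show ?thesis by (simp add: Lm_space_def)
  qed
  show thesis
  proof (rule that[of "2 * (2 * K0 + 1)"])
    show "0 < 2 * (2 * K0 + 1)" using K0 by simp
  qed (rule main)
qed

lemma sewing_error_moment:
  assumes m: "2 \<le> m" and S: "0 \<le> S" and e: "0 < \<epsilon>"
  obtains C where "0 < C" and
    "\<And>X \<Gamma> s t. 0 \<le> \<Gamma> \<Longrightarrow> small_adapted m S \<Gamma> \<epsilon> X \<Longrightarrow> (s, t) \<in> simplex2 S T \<Longrightarrow>
       (AE \<omega> in M. summable (\<lambda>n. level_error M F m X s t n \<omega>)) \<and>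
       sewing_error M F m X s t \<in> Lm_space M m \<and>
       Lm_norm M m (sewing_error M F m X s t) \<le> C * \<Gamma> * \<bar>t - s\<bar> powr (1 / 2 + \<epsilon>)"
proof (rule level_error_moment[OF m S])
  fix K :: real
  assume K: "0 < K" and lev:
    "\<And>X \<Gamma> \<epsilon> s t n. 0 \<le> \<Gamma> \<Longrightarrow> 0 < \<epsilon> \<Longrightarrow> small_adapted m S \<Gamma> \<epsilon> X \<Longrightarrow> (s, t) \<in> simplex2 S T \<Longrightarrow>
       level_error M F m X s t n \<in> Lm_space M m \<and>
       (\<integral>\<omega>. \<bar>level_error M F m X s t n \<omega>\<bar> powr m \<partial>M)
         \<le> (K * (subexp_weight n * 2 powr (- \<epsilon> * real n)) * (\<Gamma> * \<bar>t - s\<bar> powr (1 / 2 + \<epsilon>))) powr m"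
  define c where "c n = K * (subexp_weight n * 2 powr (- \<epsilon> * real n))" for n
  have c: "0 < c n" for n using K subexp_weight_ge_1[of n] by (simp add: c_def)
  have sc: "summable c" unfolding c_def by (intro summable_mult summable_subexp_weight_geometric e)
  show thesis
  proof (rule that[of "suminf c"])
    show pos: "0 < suminf c" by (rule suminf_pos[OF sc c])
    fix X \<Gamma> s t
    assume G: "0 \<le> \<Gamma>" and X: "small_adapted m S \<Gamma> \<epsilon> X" and st: "(s, t) \<in> simplex2 S T"
    define R where "R = \<Gamma> * \<bar>t - s\<bar> powr (1 / 2 + \<epsilon>)"
    have R: "0 \<le> R" using G by (simp add: R_def)
    note lv = lev[OF G e X st, folded c_def R_def]
    note ms = moment_suminf[of m R c "level_error M F m X s t" M, OF _ R c sc _ level_error_nonneg]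
    have "AE \<omega> in M. summable (\<lambda>n. level_error M F m X s t n \<omega>)"
      using lv m by (intro ms) (auto simp: Lm_space_def)
    moreover have "integrable M (\<lambda>\<omega>. \<bar>sewing_error M F m X s t \<omega>\<bar> powr m)"
      unfolding sewing_error_def using lv m by (intro ms) (auto simp: Lm_space_def)
    moreover have "sewing_error M F m X s t \<in> borel_measurable M"
      unfolding sewing_error_def using lv by (intro borel_measurable_suminf) (auto simp: Lm_space_def)
    moreover have "(\<integral>\<omega>. \<bar>sewing_error M F m X s t \<omega>\<bar> powr m \<partial>M) \<le> (suminf c * R) powr m"
      unfolding sewing_error_def using lv m by (intro ms) (auto simp: Lm_space_def)
    ultimately show "(AE \<omega> in M. summable (\<lambda>n. level_error M F m X s t n \<omega>)) \<and>
        sewing_error M F m X s t \<in> Lm_space M m \<and>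
        Lm_norm M m (sewing_error M F m X s t) \<le> suminf c * \<Gamma> * \<bar>t - s\<bar> powr (1 / 2 + \<epsilon>)"
      using m pos R by (simp add: Lm_space_def Lm_norm_le_iff R_def mult.assoc)
  qed
qed

end

section \<open>Limits in probability along dyadic partitions\<close>

lemma (in prob_space) tendsto_in_prob_diff:
  assumes X: "tendsto_in_prob M X a" and Y: "tendsto_in_prob M Y b"
    and [measurable]: "\<And>N. X N \<in> borel_measurable M" "\<And>N. Y N \<in> borel_measurable M"
      "a \<in> borel_measurable M" "b \<in> borel_measurable M"
  shows "tendsto_in_prob M (\<lambda>N \<omega>. X N \<omega> - Y N \<omega>) (\<lambda>\<omega>. a \<omega> - b \<omega>)"
  unfolding tendsto_in_prob_def
proof (intro allI impI)
  fix e :: real assume e: "0 < e"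
  define PX where "PX N = measure M {\<omega>\<in>space M. \<bar>X N \<omega> - a \<omega>\<bar> > e / 2}" for N
  define PY where "PY N = measure M {\<omega>\<in>space M. \<bar>Y N \<omega> - b \<omega>\<bar> > e / 2}" for N
  have "PX \<longlonglongrightarrow> 0" "PY \<longlonglongrightarrow> 0"
    using X Y e unfolding tendsto_in_prob_def PX_def PY_def by (auto dest: spec[of _ "e / 2"])
  then have lim: "(\<lambda>N. PX N + PY N) \<longlonglongrightarrow> 0" using tendsto_add[of PX 0 _ PY 0] by simp
  show "(\<lambda>N. measure M {\<omega>\<in>space M. \<bar>X N \<omega> - Y N \<omega> - (a \<omega> - b \<omega>)\<bar> > e}) \<longlonglongrightarrow> 0"
  proof (rule tendsto_sandwich[OF _ _ tendsto_const lim])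
    show "\<forall>\<^sub>F N in sequentially. measure M {\<omega>\<in>space M. \<bar>X N \<omega> - Y N \<omega> - (a \<omega> - b \<omega>)\<bar> > e} \<le> PX N + PY N"
    proof (intro always_eventually allI)
      fix N
      have "measure M {\<omega>\<in>space M. \<bar>X N \<omega> - Y N \<omega> - (a \<omega> - b \<omega>)\<bar> > e}
        \<le> measure M ({\<omega>\<in>space M. \<bar>X N \<omega> - a \<omega>\<bar> > e / 2} \<union> {\<omega>\<in>space M. \<bar>Y N \<omega> - b \<omega>\<bar> > e / 2})"
      proof (rule finite_measure_mono)
        have "\<bar>x - y - (u - v)\<bar> > e \<Longrightarrow> \<bar>x - u\<bar> > e / 2 \<or> \<bar>y - v\<bar> > e / 2" for x y u v :: real
          by arith
        then show "{\<omega>\<in>space M. \<bar>X N \<omega> - Y N \<omega> - (a \<omega> - b \<omega>)\<bar> > e}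
          \<subseteq> {\<omega>\<in>space M. \<bar>X N \<omega> - a \<omega>\<bar> > e / 2} \<union> {\<omega>\<in>space M. \<bar>Y N \<omega> - b \<omega>\<bar> > e / 2}"
          by blast
      qed measurable
      also have "\<dots> \<le> PX N + PY N"
        unfolding PX_def PY_def by (intro measure_Un_le) measurable
      finally show "measure M {\<omega>\<in>space M. \<bar>X N \<omega> - Y N \<omega> - (a \<omega> - b \<omega>)\<bar> > e} \<le> PX N + PY N" .
    qed
  qed simp
qed

text \<open>On the event that \<open>\<bar>a - c\<bar>\<close> exceeds \<open>Z + e\<close>, the distance of \<open>X\<^sub>N\<close> to its limit exceeds \<open>e\<close> for every \<open>N\<close>,
and the probability of the latter tends to zero.\<close>

lemma (in prob_space) tendsto_in_prob_le:
  assumes X: "tendsto_in_prob M X a"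
    and [measurable]: "\<And>N. X N \<in> borel_measurable M" "a \<in> borel_measurable M" "c \<in> borel_measurable M" "Z \<in> borel_measurable M"
    and le: "\<And>N. AE \<omega> in M. \<bar>X N \<omega> - c \<omega>\<bar> \<le> Z \<omega>"
  shows "AE \<omega> in M. \<bar>a \<omega> - c \<omega>\<bar> \<le> Z \<omega>"
proof -
  have "AE \<omega> in M. \<bar>a \<omega> - c \<omega>\<bar> \<le> Z \<omega> + 1 / real (Suc k)" for k
  proof -
    define e where "e = 1 / real (Suc k)"
    have e: "0 < e" by (simp add: e_def)
    define B where "B = {\<omega>\<in>space M. \<not> \<bar>a \<omega> - c \<omega>\<bar> \<le> Z \<omega> + e}"
    have [measurable]: "B \<in> sets M" unfolding B_def by measurable
    have "measure M B \<le> measure M {\<omega>\<in>space M. \<bar>X N \<omega> - a \<omega>\<bar> > e}" for N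
    proof (rule finite_measure_mono_AE)
      show "AE \<omega> in M. \<omega> \<in> B \<longrightarrow> \<omega> \<in> {\<omega>\<in>space M. \<bar>X N \<omega> - a \<omega>\<bar> > e}"
        using le[of N] by eventually_elim (auto simp: B_def)
    qed measurable
    moreover have "(\<lambda>N. measure M {\<omega>\<in>space M. \<bar>X N \<omega> - a \<omega>\<bar> > e}) \<longlonglongrightarrow> 0"
      using X e by (simp add: tendsto_in_prob_def)
    ultimately have "measure M B \<le> 0" by (intro LIMSEQ_le_const) auto
    then have "B \<in> null_sets M"
      by (intro null_setsI) (auto simp: emeasure_eq_measure measure_le_0_iff)
    then show ?thesis
      unfolding e_def[symmetric] by (rule AE_I') (auto simp: B_def)
  qed
  then have "AE \<omega> in M. \<forall>k. \<bar>a \<omega> - c \<omega>\<bar> \<le> Z \<omega> + 1 / real (Suc k)"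
    by (simp add: AE_all_countable)
  then show ?thesis
  proof eventually_elim
    case (elim \<omega>)
    have "(\<lambda>k. Z \<omega> + 1 / real (Suc k)) \<longlonglongrightarrow> Z \<omega> + 0"
      by (intro tendsto_intros LIMSEQ_Suc[OF lim_1_over_n])
    then show ?case using elim by (intro LIMSEQ_le_const[where X = "\<lambda>k. Z \<omega> + 1 / real (Suc k)"]) auto
  qed
qed

lemma mesh_le:
  assumes "0 \<le> d" "\<And>i. i < k \<Longrightarrow> p (Suc i) - p i \<le> d"
  shows "mesh k p \<le> d"
  unfolding mesh_def using assms by (subst Max_le_iff) auto

lemma mesh_nonneg: "0 \<le> mesh k p"
  unfolding mesh_def by (intro Max_ge) auto

lemma mesh_dyadic:
  assumes "S < T" "\<And>N i. i < k N \<Longrightarrow> p N (Suc i) - p N i \<le> (T - S) / 2 ^ N"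
  shows "(\<lambda>N. mesh (k N) (p N)) \<longlonglongrightarrow> 0"
proof (rule tendsto_sandwich[OF _ _ tendsto_const])
  show "(\<lambda>N. (T - S) / 2 ^ N) \<longlonglongrightarrow> 0" by real_asymp
  show "\<forall>\<^sub>F N in sequentially. mesh (k N) (p N) \<le> (T - S) / 2 ^ N"
    using assms by (intro always_eventually allI mesh_le) auto
qed (simp add: mesh_nonneg)

text \<open>The partition of \<open>[S, t]\<close> joins \<open>k N\<close> dyadic cells of \<open>[S, s]\<close> to the \<open>2\<^sup>N\<close> dyadic cells of \<open>[s, t]\<close>. Its first
\<open>k N\<close> cells partition \<open>[S, s]\<close>, so that \<open>dyadic_sum\<close> is the difference of two convergent sums. For
\<open>s = S\<close> the first block must be empty, since partition points increase strictly.\<close>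

lemma (in prob_space) dyadic_sum_tendsto_in_prob:
  assumes ST: "S < T" and st: "(s, t) \<in> simplex2 S T" "s < t"
    and A[measurable]: "\<And>s t. (s, t) \<in> simplex2 S T \<Longrightarrow> A s t \<in> borel_measurable M"
    and \<A>: "\<And>t. t \<in> {S..T} \<Longrightarrow> \<A> t \<in> borel_measurable M"
    and lim: "\<And>t k p. t \<in> {S..T} \<Longrightarrow> (\<forall>N. is_partition S t (k N) (p N)) \<Longrightarrow>
          (\<lambda>N. mesh (k N) (p N)) \<longlonglongrightarrow> 0 \<Longrightarrow>
          tendsto_in_prob M (\<lambda>N \<omega>. \<Sum>i<k N. A (p N i) (p N (Suc i)) \<omega>) (\<A> t)"
  shows "tendsto_in_prob M (dyadic_sum A s t) (\<lambda>\<omega>. \<A> t \<omega> - \<A> s \<omega>)"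
proof -
  define k :: "nat \<Rightarrow> nat" where "k N = (if s = S then 0 else 2 ^ N)" for N
  define p where "p N i = (if i < k N then dyadic S s N i else dyadic s t N (i - k N))" for N i
  have S: "S \<le> s" "t \<le> T" and sS: "s \<in> {S..T}" and tS: "t \<in> {S..T}" using st by (auto simp: simplex2_def)
  have low: "p N i = dyadic S s N i" if "i \<le> k N" for N i
    using that by (auto simp: p_def k_def split: if_splits)
  have high: "p N (k N + i) = dyadic s t N i" for N i
    by (simp add: p_def)
  have kS: "S < s" if "i < k N" for i N
    using that S by (auto simp: k_def split: if_splits)
  have pk: "p N (k N) = s" for N using high[of N 0] by simp
  have p0: "p N 0 = S" for N using low[of 0 N] by simp
  have up1: "p N i < p N (Suc i)" "p N (Suc i) - p N i \<le> (T - S) / 2 ^ N" if "i < k N" for N i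
  proof -
    have "p N i = dyadic S s N i" "p N (Suc i) = dyadic S s N (Suc i)" using that low by simp_all
    then show "p N i < p N (Suc i)" "p N (Suc i) - p N i \<le> (T - S) / 2 ^ N"
      using kS[OF that] S st by (auto simp: dyadic_Suc intro!: divide_right_mono)
  qed
  have up: "p N i < p N (Suc i)" "p N (Suc i) - p N i \<le> (T - S) / 2 ^ N" for N i
  proof -
    have "p N i < p N (Suc i) \<and> p N (Suc i) - p N i \<le> (T - S) / 2 ^ N"
    proof (cases "i < k N")
      case True
      then show ?thesis using up1 by blast
    next
      case False
      then obtain j where "i = k N + j" using le_Suc_ex[of "k N" i] by auto
      then have "p N i = dyadic s t N j" "p N (Suc i) = dyadic s t N (Suc j)"
        using high[of N j] high[of N "Suc j"] by simp_all
      then show ?thesis using S st by (auto simp: dyadic_Suc intro!: divide_right_mono)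
    qed
    then show "p N i < p N (Suc i)" "p N (Suc i) - p N i \<le> (T - S) / 2 ^ N" by auto
  qed
  have part: "is_partition S s (k N) (p N)" "is_partition S t (k N + 2 ^ N) (p N)" for N
    using up high[of N "2 ^ N"] by (auto simp: is_partition_def p0 pk)
  have in_simplex: "(p N i, p N (Suc i)) \<in> simplex2 S T" if i: "i < k N + 2 ^ N" for N i
  proof -
    have mono: "p N i \<le> p N j" if "i \<le> j" for i j
      using lift_Suc_mono_le[of "p N"] up(1)[of N] that by (simp add: less_imp_le)
    show ?thesis
      using mono[of 0 i] mono[of i "Suc i"] mono[of "Suc i" "k N + 2 ^ N"] i S high[of N "2 ^ N"]
      by (auto simp: simplex2_def p0)
  qed
  have "tendsto_in_prob M (\<lambda>N \<omega>. \<Sum>i<k N. A (p N i) (p N (Suc i)) \<omega>) (\<A> s)"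
    by (rule lim[OF sS]) (auto intro: part mesh_dyadic[OF ST] up)
  moreover have "tendsto_in_prob M (\<lambda>N \<omega>. \<Sum>i<k N + 2 ^ N. A (p N i) (p N (Suc i)) \<omega>) (\<A> t)"
    by (rule lim[OF tS]) (auto intro: part mesh_dyadic[OF ST] up)
  ultimately have "tendsto_in_prob M (\<lambda>N \<omega>. (\<Sum>i<k N + 2 ^ N. A (p N i) (p N (Suc i)) \<omega>)
      - (\<Sum>i<k N. A (p N i) (p N (Suc i)) \<omega>)) (\<lambda>\<omega>. \<A> t \<omega> - \<A> s \<omega>)"
    using \<A>[OF sS] \<A>[OF tS] in_simplex
    by (intro tendsto_in_prob_diff borel_measurable_sum A) auto
  also have "(\<lambda>N \<omega>. (\<Sum>i<k N + 2 ^ N. A (p N i) (p N (Suc i)) \<omega>)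
      - (\<Sum>i<k N. A (p N i) (p N (Suc i)) \<omega>)) = dyadic_sum A s t"
  proof (intro ext)
    fix N \<omega>
    have split: "(\<Sum>i<a + b. f i) = (\<Sum>i<a. f i) + (\<Sum>i<b. f (a + i))" for a b :: nat and f :: "nat \<Rightarrow> real"
      by (induction b) simp_all
    have "p N (Suc (k N + i)) = dyadic s t N (Suc i)" for i using high[of N "Suc i"] by simp
    then show "(\<Sum>i<k N + 2 ^ N. A (p N i) (p N (Suc i)) \<omega>)
      - (\<Sum>i<k N. A (p N i) (p N (Suc i)) \<omega>) = dyadic_sum A s t N \<omega>"
      by (simp add: split high dyadic_sum_def dyadic_cell_def)
  qed
  finally show ?thesis .
qed

section \<open>The almost sure bound\<close>

text \<open>The control enters the almost sure bound, which has to be measurable for the passage to the limit in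
probability.\<close>

lemma random_control_section:
  assumes l: "random_control M S T l" and st: "(s, t) \<in> simplex2 S T"
  shows "l s t \<in> borel_measurable M"
proof -
  have "(\<lambda>\<omega>. ((s, t), \<omega>)) \<in> measurable M (restrict_space borel (simplex2 S T) \<Otimes>\<^sub>M M)"
    using st by (intro measurable_Pair measurable_const measurable_ident_sets) (auto simp: space_restrict_space)
  from measurable_compose[OF this, of "\<lambda>((s, t), \<omega>). l s t \<omega>" borel] l
  show ?thesis by (simp add: random_control_def)
qed

lemma random_control_dyadic_sum:
  assumes l: "random_control M S T l" and st: "(s, t) \<in> simplex2 S T"
  shows "AE \<omega> in M. (\<Sum>i<2^n. dyadic_cell l s t n i \<omega>) \<le> l s t \<omega>"
proof -
  have st': "S \<le> s" "s \<le> t" "t \<le> T" using st by (auto simp: simplex2_def)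
  have "k \<le> 2 ^ n \<Longrightarrow> AE \<omega> in M. (\<Sum>i<k. dyadic_cell l s t n i \<omega>) \<le> l s (dyadic s t n k) \<omega>" for k
  proof (induction k)
    case 0
    have "(s, s) \<in> simplex2 S T" using st' by (simp add: simplex2_def)
    then show ?case using l by (auto simp: random_control_def)
  next
    case (Suc k)
    have "AE \<omega> in M. l s (dyadic s t n k) \<omega> + l (dyadic s t n k) (dyadic s t n (Suc k)) \<omega>
        \<le> l s (dyadic s t n (Suc k)) \<omega>"
      using l st' dyadic_bounds[of s t k n] dyadic_bounds[of s t "Suc k" n] Suc.prems
        dyadic_mono[of s t k "Suc k" n]
      by (auto simp: random_control_def)
    moreover have "AE \<omega> in M. (\<Sum>i<k. dyadic_cell l s t n i \<omega>) \<le> l s (dyadic s t n k) \<omega>"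
      using Suc by simp
    ultimately show ?case by eventually_elim (simp add: dyadic_cell_def)
  qed
  from this[of "2 ^ n"] show ?thesis by simp
qed

text \<open>The telescoping sum is bounded level by level. Outside one null set the drift hypothesis and the
superadditivity of the control hold on all dyadic cells at once, so the bound is uniform in the
number of levels.\<close>

lemma (in filtered_prob_space) dyadic_sum_error_bound:
  assumes m: "0 < m" and ab: "0 \<le> \<alpha>" "0 \<le> \<beta>" "1 < \<alpha> + \<beta>"
  obtains C where "0 \<le> C" and
    "\<And>A l \<Gamma> s t N. 0 \<le> \<Gamma> \<Longrightarrow> random_control M S T l \<Longrightarrow>
       (\<And>s t. (s, t) \<in> simplex2 S T \<Longrightarrow> AE \<omega> in M.
          \<bar>real_cond_exp M (F ((s + t) / 2)) (midpoint_increments A s t) \<omega>\<bar>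
            \<le> \<Gamma> * npow \<bar>t - s\<bar> \<alpha> * npow (l s t \<omega>) \<beta>) \<Longrightarrow>
       (s, t) \<in> simplex2 S T \<Longrightarrow>
       AE \<omega> in M. summable (\<lambda>n. level_error M F m (midpoint_increments A) s t n \<omega>) \<Longrightarrow>
       AE \<omega> in M. \<bar>dyadic_sum A s t N \<omega> - A s t \<omega>\<bar>
         \<le> C * (\<Gamma> * npow \<bar>t - s\<bar> \<alpha> * npow (l s t \<omega>) \<beta>)
           + sewing_error M F m (midpoint_increments A) s t \<omega>"
proof (rule drift_level_bound[OF ab])
  fix a :: "nat \<Rightarrow> real"
  assume sa: "summable a" and a0: "\<And>n. 0 \<le> a n" and bound:
    "\<And>n (x :: nat \<Rightarrow> real) (K :: nat \<Rightarrow> real) L h G D. 0 \<le> h \<Longrightarrow> 0 \<le> G \<Longrightarrow> 0 \<le> D \<Longrightarrow>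
       (\<And>i. i < 2^n \<Longrightarrow> 0 \<le> x i) \<Longrightarrow> (\<Sum>i<2^n. x i) \<le> L \<Longrightarrow>
       (\<And>i. i < 2^n \<Longrightarrow> K i \<le> G * npow (h / 2 ^ n) \<alpha> * npow (x i) \<beta>) \<Longrightarrow>
       (\<And>i. i < 2^n \<Longrightarrow> K i \<le> D) \<Longrightarrow>
       (\<Sum>i<2^n. K i) \<le> a n * (G * npow h \<alpha> * npow L \<beta>) + subexp_weight n * D"
  show thesis
  proof (rule that[of "suminf a"])
    show "0 \<le> suminf a" by (rule suminf_nonneg[OF sa a0])
    fix A :: "real \<Rightarrow> real \<Rightarrow> 'a \<Rightarrow> real" and l \<Gamma> s t N
    assume G: "0 \<le> \<Gamma>" and l: "random_control M S T l"
      and K: "\<And>s t. (s, t) \<in> simplex2 S T \<Longrightarrow> AE \<omega> in M.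
          \<bar>real_cond_exp M (F ((s + t) / 2)) (midpoint_increments A s t) \<omega>\<bar>
            \<le> \<Gamma> * npow \<bar>t - s\<bar> \<alpha> * npow (l s t \<omega>) \<beta>"
      and st: "(s, t) \<in> simplex2 S T"
      and summ: "AE \<omega> in M. summable (\<lambda>n. level_error M F m (midpoint_increments A) s t n \<omega>)"
    define X where "X = midpoint_increments A"
    have h: "0 \<le> t - s" using st by (simp add: simplex2_def)
    have "AE \<omega> in M. \<forall>n. \<forall>i\<in>{..<2^n}. \<bar>drift M F X s t n i \<omega>\<bar>
        \<le> \<Gamma> * npow ((t - s) / 2 ^ n) \<alpha> * npow (dyadic_cell l s t n i \<omega>) \<beta>"
      unfolding AE_all_countable
    proof (intro allI AE_finite_allI)
      fix n i :: nat assume "i \<in> {..<2^n}"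
      then have "(dyadic s t n i, dyadic s t n (Suc i)) \<in> simplex2 S T"
        by (intro dyadic_cell_in_simplex[OF st]) simp
      from K[OF this] show "AE \<omega> in M. \<bar>drift M F X s t n i \<omega>\<bar>
        \<le> \<Gamma> * npow ((t - s) / 2 ^ n) \<alpha> * npow (dyadic_cell l s t n i \<omega>) \<beta>"
        using h by (auto simp: drift_def dyadic_mid_def dyadic_cell_def X_def dyadic_Suc)
    qed simp
    moreover have "AE \<omega> in M. \<forall>n. (\<Sum>i<2^n. dyadic_cell l s t n i \<omega>) \<le> l s t \<omega>"
      unfolding AE_all_countable using random_control_dyadic_sum[OF l st] by blast
    moreover note summ[folded X_def] AE_space
    ultimately show "AE \<omega> in M. \<bar>dyadic_sum A s t N \<omega> - A s t \<omega>\<bar>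
       \<le> suminf a * (\<Gamma> * npow \<bar>t - s\<bar> \<alpha> * npow (l s t \<omega>) \<beta>) + sewing_error M F m (midpoint_increments A) s t \<omega>"
      unfolding X_def[symmetric]
    proof eventually_elim
      case (elim \<omega>)
      define g where "g = \<Gamma> * npow (t - s) \<alpha> * npow (l s t \<omega>) \<beta>"
      have g: "0 \<le> g" using G by (simp add: g_def npow_nonneg)
      have level: "\<bar>\<Sum>i<2^n. dyadic_cell X s t n i \<omega>\<bar> \<le> a n * g + level_error M F m X s t n \<omega>" for n
      proof -
        have l0: "0 \<le> dyadic_cell l s t n i \<omega>" if "i < 2 ^ n" for i
          using l dyadic_cell_in_simplex[OF st that] elim by (force simp: random_control_def dyadic_cell_def)
        have "(\<Sum>i<2^n. \<bar>drift M F X s t n i \<omega>\<bar>) \<le> a n * g + subexp_weight n * drift_norm M F m X s t n \<omega>"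
          unfolding g_def using elim abs_drift_le_norm[OF m]
          by (intro bound[OF h G drift_norm_nonneg l0]) auto
        moreover have "(\<Sum>i<2^n. dyadic_cell X s t n i \<omega>) = noise M F X s t n \<omega> + (\<Sum>i<2^n. drift M F X s t n i \<omega>)"
          by (simp add: noise_def sum_subtractf)
        moreover have "\<bar>\<Sum>i<2^n. drift M F X s t n i \<omega>\<bar> \<le> (\<Sum>i<2^n. \<bar>drift M F X s t n i \<omega>\<bar>)"
          by (rule sum_abs)
        ultimately show ?thesis unfolding level_error_def by linarith
      qed
      have "\<bar>dyadic_sum A s t N \<omega> - A s t \<omega>\<bar> = \<bar>\<Sum>n<N. \<Sum>i<2^n. dyadic_cell X s t n i \<omega>\<bar>"
        using dyadic_sum_telescope[of A s t \<omega> N] by (simp add: X_def abs_minus_commute)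
      also have "\<dots> \<le> (\<Sum>n<N. a n * g + level_error M F m X s t n \<omega>)"
        by (intro order_trans[OF sum_abs] sum_mono level)
      also have "\<dots> = (\<Sum>n<N. a n) * g + (\<Sum>n<N. level_error M F m X s t n \<omega>)"
        by (simp add: sum.distrib sum_distrib_right)
      also have "\<dots> \<le> suminf a * g + sewing_error M F m X s t \<omega>"
        unfolding sewing_error_def using sa a0 g elim
        by (intro add_mono mult_right_mono sum_le_suminf) (auto intro: level_error_nonneg)
      finally show ?case using h by (simp add: g_def)
    qed
  qed
qed

lemma Lm_space_diff:
  assumes m: "1 \<le> m" and f: "f \<in> Lm_space M m" and g: "g \<in> Lm_space M m"
  shows "(\<lambda>\<omega>. f \<omega> - g \<omega>) \<in> Lm_space M m"
proof -
  have "integrable M (\<lambda>\<omega>. \<bar>f \<omega> + - g \<omega>\<bar> powr m)"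
    using f g by (intro moment_add[OF m]) (auto simp: Lm_space_def)
  then show ?thesis using f g by (auto simp: Lm_space_def)
qed

lemma (in filtered_prob_space) midpoint_increments_adapted:
  assumes m: "1 \<le> m" and S: "0 \<le> S" and st: "(s, t) \<in> simplex2 S T"
    and A: "\<forall>(s, t)\<in>simplex2 S T. A s t \<in> Lm_space M m \<and> A s t \<in> borel_measurable (F t)"
  shows "midpoint_increments A s t \<in> Lm_space M m"
    and "midpoint_increments A s t \<in> borel_measurable (F t)"
proof -
  define u where "u = (s + t) / 2"
  have u: "s \<le> u" "u \<le> t" and st': "S \<le> s" "t \<le> T" using st by (auto simp: simplex2_def u_def)
  have su: "(s, u) \<in> simplex2 S T" and ut: "(u, t) \<in> simplex2 S T"
    using u st' by (auto simp: simplex2_def)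
  show "midpoint_increments A s t \<in> Lm_space M m"
    unfolding midpoint_increments_def increment_def u_def[symmetric]
    using A st su ut by (intro Lm_space_diff[OF m]) auto
  have "A s u \<in> borel_measurable (F t)"
    using A su S u st' by (intro measurable_F_mono[of _ u t]) auto
  then show "midpoint_increments A s t \<in> borel_measurable (F t)"
    unfolding midpoint_increments_def increment_def u_def[symmetric]
    using A st ut by (intro borel_measurable_diff) auto
qed

theorem theorem4p7:
  fixes M :: "'a measure" and F :: "real \<Rightarrow> 'a measure" and S T m :: real
  assumes "prob_space M"
    and "filtration_on M T F"
    and "0 \<le> S" and "S < T" and "2 \<le> m"
  shows "\<exists>\<Phi>. Lm_functional M m S T \<Phi> \<and>
    (\<forall>(A :: real \<Rightarrow> real \<Rightarrow> 'a \<Rightarrow> real) (l :: real \<Rightarrow> real \<Rightarrow> 'a \<Rightarrow> real) (\<A> :: real \<Rightarrow> 'a \<Rightarrow> real)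
        (\<Gamma>1 :: real) (\<alpha>1 :: real) (\<beta>1 :: real) (\<Gamma>2 :: real) (\<epsilon>2 :: real).
      (\<forall>(s, t)\<in>simplex2 S T. A s t \<in> Lm_space M m \<and> A s t \<in> borel_measurable (F t)) \<longrightarrow>
      random_control M S T l \<longrightarrow>
      0 \<le> \<Gamma>1 \<longrightarrow> 0 \<le> \<alpha>1 \<longrightarrow> 0 \<le> \<beta>1 \<longrightarrow> 1 < \<alpha>1 + \<beta>1 \<longrightarrow>
      (\<forall>(s, t)\<in>simplex2 S T. AE \<omega> in M.
          \<bar>real_cond_exp M (F ((s + t) / 2)) (increment A s ((s + t) / 2) t) \<omega>\<bar>
            \<le> \<Gamma>1 * npow \<bar>t - s\<bar> \<alpha>1 * npow (l s t \<omega>) \<beta>1) \<longrightarrow>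
      0 \<le> \<Gamma>2 \<longrightarrow> 0 < \<epsilon>2 \<longrightarrow>
      (\<forall>(s, t)\<in>simplex2 S T.
          Lm_norm M m (increment A s ((s + t) / 2) t) \<le> \<Gamma>2 * \<bar>t - s\<bar> powr (1 / 2 + \<epsilon>2)) \<longrightarrow>
      (\<forall>t\<in>{S..T}. \<A> t \<in> borel_measurable M) \<longrightarrow>
      (\<forall>t\<in>{S..T}. \<forall>(k :: nat \<Rightarrow> nat) (p :: nat \<Rightarrow> nat \<Rightarrow> real).
          (\<forall>N. is_partition S t (k N) (p N)) \<longrightarrow>
          (\<lambda>N. mesh (k N) (p N)) \<longlonglongrightarrow> 0 \<longrightarrow>
          tendsto_in_prob M (\<lambda>N \<omega>. \<Sum>i<k N. A (p N i) (p N (Suc i)) \<omega>) (\<A> t)) \<longrightarrow>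
      (\<exists>B C. B = \<Phi> (midpoint_increments A) \<and> 0 < C \<and>
         (\<forall>(s, t)\<in>simplex2 S T.
            B s t \<in> Lm_space M m \<and>
            (AE \<omega> in M. \<bar>\<A> t \<omega> - \<A> s \<omega> - A s t \<omega>\<bar>
                \<le> C * \<Gamma>1 * npow \<bar>t - s\<bar> \<alpha>1 * npow (l s t \<omega>) \<beta>1 + B s t \<omega>) \<and>
            Lm_norm M m (B s t) \<le> C * \<Gamma>2 * \<bar>t - s\<bar> powr (1 / 2 + \<epsilon>2))))"
proof -
  interpret filtered_prob_space M F T
    using assms(1,2) by (simp add: filtered_prob_space_def filtered_prob_space_axioms_def)
  note S = \<open>0 \<le> S\<close> and m = \<open>2 \<le> m\<close>
  show ?thesis
  proof (intro exI[of _ "sewing_error M F m"] conjI allI impI)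
    show "Lm_functional M m S T (sewing_error M F m)" by (rule sewing_error_functional[OF S])
    fix A :: "real \<Rightarrow> real \<Rightarrow> 'a \<Rightarrow> real" and l :: "real \<Rightarrow> real \<Rightarrow> 'a \<Rightarrow> real" and \<A> :: "real \<Rightarrow> 'a \<Rightarrow> real"
      and \<Gamma>1 \<alpha>1 \<beta>1 \<Gamma>2 \<epsilon>2 :: real
    assume A: "\<forall>(s, t)\<in>simplex2 S T. A s t \<in> Lm_space M m \<and> A s t \<in> borel_measurable (F t)"
      and l: "random_control M S T l"
      and G1: "0 \<le> \<Gamma>1" and ab: "0 \<le> \<alpha>1" "0 \<le> \<beta>1" "1 < \<alpha>1 + \<beta>1"
      and drift: "\<forall>(s, t)\<in>simplex2 S T. AE \<omega> in M.
          \<bar>real_cond_exp M (F ((s + t) / 2)) (increment A s ((s + t) / 2) t) \<omega>\<bar>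
            \<le> \<Gamma>1 * npow \<bar>t - s\<bar> \<alpha>1 * npow (l s t \<omega>) \<beta>1"
      and G2: "0 \<le> \<Gamma>2" and e: "0 < \<epsilon>2"
      and size: "\<forall>(s, t)\<in>simplex2 S T.
          Lm_norm M m (increment A s ((s + t) / 2) t) \<le> \<Gamma>2 * \<bar>t - s\<bar> powr (1 / 2 + \<epsilon>2)"
      and \<A>: "\<forall>t\<in>{S..T}. \<A> t \<in> borel_measurable M"
      and lim: "\<forall>t\<in>{S..T}. \<forall>(k :: nat \<Rightarrow> nat) (p :: nat \<Rightarrow> nat \<Rightarrow> real).
          (\<forall>N. is_partition S t (k N) (p N)) \<longrightarrow>
          (\<lambda>N. mesh (k N) (p N)) \<longlonglongrightarrow> 0 \<longrightarrow>
          tendsto_in_prob M (\<lambda>N \<omega>. \<Sum>i<k N. A (p N i) (p N (Suc i)) \<omega>) (\<A> t)"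
    define X where "X = midpoint_increments A"
    define B where "B = sewing_error M F m X"
    have "small_adapted m S \<Gamma>2 \<epsilon>2 X"
      unfolding small_adapted_def
    proof (intro ballI, clarify)
      fix s t assume st: "(s, t) \<in> simplex2 S T"
      have "1 \<le> m" using m by simp
      from midpoint_increments_adapted[OF this S st A] size st
      show "X s t \<in> Lm_space M m \<and> X s t \<in> borel_measurable (F t) \<and>
          Lm_norm M m (X s t) \<le> \<Gamma>2 * \<bar>t - s\<bar> powr (1 / 2 + \<epsilon>2)"
        by (auto simp: X_def midpoint_increments_def)
    qed
    with sewing_error_moment[OF m S e] G2 obtain C2 where C2: "0 < C2" and err:
      "\<And>s t. (s, t) \<in> simplex2 S T \<Longrightarrow> (AE \<omega> in M. summable (\<lambda>n. level_error M F m X s t n \<omega>)) \<and>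
         B s t \<in> Lm_space M m \<and> Lm_norm M m (B s t) \<le> C2 * \<Gamma>2 * \<bar>t - s\<bar> powr (1 / 2 + \<epsilon>2)"
      unfolding B_def by metis
    have m0: "0 < m" using m by simp
    have drift': "AE \<omega> in M. \<bar>real_cond_exp M (F ((s + t) / 2)) (midpoint_increments A s t) \<omega>\<bar>
        \<le> \<Gamma>1 * npow \<bar>t - s\<bar> \<alpha>1 * npow (l s t \<omega>) \<beta>1" if "(s, t) \<in> simplex2 S T" for s t
      using drift that by (auto simp: midpoint_increments_def)
    obtain C1 where C1: "0 \<le> C1" and path:
      "\<And>s t N. (s, t) \<in> simplex2 S T \<Longrightarrow> AE \<omega> in M. \<bar>dyadic_sum A s t N \<omega> - A s t \<omega>\<bar>
       \<le> C1 * (\<Gamma>1 * npow \<bar>t - s\<bar> \<alpha>1 * npow (l s t \<omega>) \<beta>1) + B s t \<omega>"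
    proof (rule dyadic_sum_error_bound[OF m0 ab, of S])
      fix C assume "0 \<le> C" and b: "\<And>A l \<Gamma> s t N. 0 \<le> \<Gamma> \<Longrightarrow> random_control M S T l \<Longrightarrow>
       (\<And>s t. (s, t) \<in> simplex2 S T \<Longrightarrow> AE \<omega> in M.
          \<bar>real_cond_exp M (F ((s + t) / 2)) (midpoint_increments A s t) \<omega>\<bar>
            \<le> \<Gamma> * npow \<bar>t - s\<bar> \<alpha>1 * npow (l s t \<omega>) \<beta>1) \<Longrightarrow>
       (s, t) \<in> simplex2 S T \<Longrightarrow>
       AE \<omega> in M. summable (\<lambda>n. level_error M F m (midpoint_increments A) s t n \<omega>) \<Longrightarrow>
       AE \<omega> in M. \<bar>dyadic_sum A s t N \<omega> - A s t \<omega>\<bar>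
         \<le> C * (\<Gamma> * npow \<bar>t - s\<bar> \<alpha>1 * npow (l s t \<omega>) \<beta>1)
           + sewing_error M F m (midpoint_increments A) s t \<omega>"
      show thesis
        by (rule that[OF \<open>0 \<le> C\<close>]) (use b[OF G1 l drift'] err in \<open>simp add: B_def X_def\<close>)
    qed
    define C where "C = C1 + C2"
    have AM: "A s t \<in> borel_measurable M" if "(s, t) \<in> simplex2 S T" for s t
      using A that by (auto simp: Lm_space_def)
    show "\<exists>B C. B = sewing_error M F m (midpoint_increments A) \<and> 0 < C \<and>
         (\<forall>(s, t)\<in>simplex2 S T.
            B s t \<in> Lm_space M m \<and>
            (AE \<omega> in M. \<bar>\<A> t \<omega> - \<A> s \<omega> - A s t \<omega>\<bar>
                \<le> C * \<Gamma>1 * npow \<bar>t - s\<bar> \<alpha>1 * npow (l s t \<omega>) \<beta>1 + B s t \<omega>) \<and>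
            Lm_norm M m (B s t) \<le> C * \<Gamma>2 * \<bar>t - s\<bar> powr (1 / 2 + \<epsilon>2))"
    proof (intro exI[of _ B] exI[of _ C] conjI ballI)
      show "B = sewing_error M F m (midpoint_increments A)" by (simp add: B_def X_def)
      show "0 < C" using C1 C2 by (simp add: C_def)
      fix z assume "z \<in> simplex2 S T"
      then obtain s t where z: "z = (s, t)" and st: "(s, t) \<in> simplex2 S T" by (cases z) auto
      define Z where "Z \<omega> = C1 * (\<Gamma>1 * npow \<bar>t - s\<bar> \<alpha>1 * npow (l s t \<omega>) \<beta>1) + B s t \<omega>" for \<omega>
      have "(\<lambda>\<omega>. npow (l s t \<omega>) \<beta>1) \<in> borel_measurable M"
        using random_control_section[OF l st] by (cases "\<beta>1 = 0") (auto simp: npow_def)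
      then have Zm: "Z \<in> borel_measurable M"
        using err[OF st] by (auto simp: Z_def[abs_def] Lm_space_def)
      have cell: "AE \<omega> in M. \<bar>\<A> t \<omega> - \<A> s \<omega> - A s t \<omega>\<bar> \<le> Z \<omega>"
      proof (cases "s = t")
        case True
        \<comment> \<open>All cells are \<open>[s, s]\<close>, so the pathwise bound for \<open>N = 1\<close> is already the bound for \<open>A\<^sub>s\<^sub>,\<^sub>s\<close>.\<close>
        have "dyadic_sum A s t N \<omega> - A s t \<omega> = (2 ^ N - 1) * A s t \<omega>" for N \<omega>
          using True by (simp add: dyadic_sum_def dyadic_cell_def dyadic_def algebra_simps)
        then show ?thesis using path[OF st, of 1] True by (simp add: Z_def)
      next
        case False
        then have "s < t" using st by (simp add: simplex2_def)
        show ?thesis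
        proof (rule tendsto_in_prob_le[where X = "dyadic_sum A s t"])
          show "tendsto_in_prob M (dyadic_sum A s t) (\<lambda>\<omega>. \<A> t \<omega> - \<A> s \<omega>)"
            using lim \<A> AM by (intro dyadic_sum_tendsto_in_prob[OF \<open>S < T\<close> st \<open>s < t\<close>]) auto
          show "dyadic_sum A s t N \<in> borel_measurable M" for N
            unfolding dyadic_sum_def dyadic_cell_def
            using AM dyadic_cell_in_simplex[OF st] by (intro borel_measurable_sum) auto
          show "(\<lambda>\<omega>. \<A> t \<omega> - \<A> s \<omega>) \<in> borel_measurable M"
            using \<A> st by (intro borel_measurable_diff) (auto simp: simplex2_def)
        qed (use AM[OF st] Zm path[OF st, folded Z_def] in auto)
      qed
      have "Z \<omega> \<le> C * \<Gamma>1 * npow \<bar>t - s\<bar> \<alpha>1 * npow (l s t \<omega>) \<beta>1 + B s t \<omega>" for \<omega>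
      proof -
        have "C1 * (\<Gamma>1 * npow \<bar>t - s\<bar> \<alpha>1 * npow (l s t \<omega>) \<beta>1) \<le> C * (\<Gamma>1 * npow \<bar>t - s\<bar> \<alpha>1 * npow (l s t \<omega>) \<beta>1)"
          using C2 G1 by (intro mult_right_mono) (auto simp: C_def npow_nonneg)
        then show ?thesis by (simp add: Z_def mult.assoc)
      qed
      with cell have 1: "AE \<omega> in M. \<bar>\<A> t \<omega> - \<A> s \<omega> - A s t \<omega>\<bar>
            \<le> C * \<Gamma>1 * npow \<bar>t - s\<bar> \<alpha>1 * npow (l s t \<omega>) \<beta>1 + B s t \<omega>"
        by (auto elim!: eventually_mono intro: order_trans)
      have "C2 * \<Gamma>2 * \<bar>t - s\<bar> powr (1 / 2 + \<epsilon>2) \<le> C * \<Gamma>2 * \<bar>t - s\<bar> powr (1 / 2 + \<epsilon>2)"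
        using C1 G2 by (intro mult_right_mono) (auto simp: C_def)
      with err[OF st] have 2: "Lm_norm M m (B s t) \<le> C * \<Gamma>2 * \<bar>t - s\<bar> powr (1 / 2 + \<epsilon>2)"
        by linarith
      show "case z of (s, t) \<Rightarrow> B s t \<in> Lm_space M m \<and>
            (AE \<omega> in M. \<bar>\<A> t \<omega> - \<A> s \<omega> - A s t \<omega>\<bar>
                \<le> C * \<Gamma>1 * npow \<bar>t - s\<bar> \<alpha>1 * npow (l s t \<omega>) \<beta>1 + B s t \<omega>) \<and>
            Lm_norm M m (B s t) \<le> C * \<Gamma>2 * \<bar>t - s\<bar> powr (1 / 2 + \<epsilon>2)"
        using err[OF st] 1 2 by (simp add: z)
    qed
  qed
qed

end
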